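(* The connected component of any weight pair $(\sigma,\pi)$ in the variable-multiplication weight poset $\mathcal{P}$ contains a unique minimal element $(\sigma^{red},\pi^{red})$ (called the reduction of $(\sigma,\pi)$), and $$\mathsf{RSK}_{\sigma^{red},\pi^{red}}=\mathsf{RSK}_{\sigma,\pi}$$ (equality of matrices).
   Context: $\mathbb{N}=\{0,1,2,\dots\}$. RSK. A semistandard Young tableau is a filling of a Young diagram (English notation) by positive integers, weakly increasing along rows and strictly increasing down columns. Row insertion $P\leftarrow p$: if no label in the first row of $P$ exceeds $p$, append $p$ to the end of the first row; otherwise replace the leftmost occurrence of the smallest label $p'>p$ of the first row by $p$, and insert $p'$ in the same way into the tableau formed by the remaining rows. Inserting a biletter $(p|q)$ into a pair $(P,Q)$ of tableaux of the same shape yields $(P\leftarrow p,Q^\uparrow)$, where $Q^\uparrow$ is $Q$ with a new box labelled $q$ placed where $P\leftarrow p$ has a new box. For an $m\times n$ matrix $\alpha$ with entries in $\mathbb{N}$, list biletters by reading the entries of $\alpha$ down columns, columns from left to right, recording $\alpha_{i,j}$ copies of $(i|j)$. $\mathrm{RSK}(\alpha)=(P,Q)$ is the result of inserting these biletters successively into $(\emptyset,\emptyset)$. Operator. Let $R_{m,n}=\mathbb{C}[z_{ij}]_{1\le i\le m,1\le j\le n}$, $Z=[z_{ij}]$, and $z^\alpha=\prod_{i,j} z_{ij}^{\alpha_{i,j}}$. For semistandard $P,Q$ of the same shape, $[P|Q]\in R_{m,n}$ is the product over column positions $c$ of the minors of $Z$ whose row indices are the entries of the $c$-th column of $P$ and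 whose column indices are the entries of the $c$-th column of $Q$. Let $\mathsf{RSK}:R_{m,n}\to R_{m,n}$ be the linear map with $z^\alpha\mapsto[P|Q]$ where $(P,Q)=\mathrm{RSK}(\alpha)$. Weight spaces. A weight pair of degree $d$ is $(\sigma,\pi)\in\mathbb{N}^m\times\mathbb{N}^n$ with $\sum_i\sigma_i=\sum_j\pi_j=d$. $\mathsf{Cont}_{\sigma,\pi}$ is the set of $m\times n$ matrices over $\mathbb{N}$ with row sums $\sigma$ and column sums $\pi$, and $R_{\sigma,\pi}$ is the span of $\{z^\alpha:\alpha\in\mathsf{Cont}_{\sigma,\pi}\}$; it is preserved by $\mathsf{RSK}$. $\mathsf{RSK}_{\sigma,\pi}$ is the matrix of the restriction: its $(\beta,\alpha)$ entry is the coefficient of $z^\beta$ in $\mathsf{RSK}(z^\alpha)$, with $\mathsf{Cont}_{\sigma,\pi}$ ordered so that $\alpha$ comes before $\alpha'$ if $z^\alpha>z^{\alpha'}$ in the lexicographic monomial order with $z_{11}>z_{21}>\dots>z_{m1}>z_{12}>\dots>z_{mn}$. Poset. $\mathcal{P}$ is the poset on weight pairs, graded by degree, defined by the covering relations $(\sigma,\pi)\prec(\sigma+\vec e_k,\pi+\vec e_\ell)$ whenever $\sigma_k+\pi_\ell\geq d$, where $d$ is the degree of $(\sigma,\pi)$ and $\vec e_k,\vec e_\ell$ are standard basis vectors. Minimal elements of $\mathcal{P}$ are called reduced; they are the pairs with $\max_i\sigma_i+\max_j\pi_j\leq d$. *)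

theory Defs
  imports
    "HOL-Library.Poly_Mapping"
    "Jordan_Normal_Form.Determinant"
begin

section \<open>The Robinson--Schensted--Knuth correspondence\<close>

text \<open>
  A tableau is the list of its rows, from top to bottom; the rows are nonempty lists of positive
  integers. Lists are indexed from 0, whereas labels, matrix positions and variables are indexed
  from 1.
\<close>

type_synonym tableau = "nat list list"

fun row_insert :: "tableau \<Rightarrow> nat \<Rightarrow> tableau" where
  "row_insert [] p = [[p]]"
| "row_insert (r # rs) p =
    (if \<forall>x\<in>set r. x \<le> p then (r @ [p]) # rs
     else (let p' = Min {x \<in> set r. p < x};
               c = (LEAST c. c < length r \<and> r ! c = p')
           in r[c := p] # row_insert rs p'))"

definition row_len :: "tableau \<Rightarrow> nat \<Rightarrow> nat" where
  "row_len T i = (if i < length T then length (T ! i) else 0)"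

definition add_box :: "tableau \<Rightarrow> nat \<Rightarrow> nat \<Rightarrow> tableau" where
  "add_box Q i q = (if i < length Q then Q[i := Q ! i @ [q]] else Q @ [[q]])"

text \<open>
  The row of the new box of \<open>P \<leftarrow> p\<close> is the one in which its shape differs from that of \<open>P\<close>.
\<close>

definition insert_biletter :: "nat \<times> nat \<Rightarrow> tableau \<times> tableau \<Rightarrow> tableau \<times> tableau" where
  "insert_biletter = (\<lambda>(p, q) (P, Q).
     let P' = row_insert P p
     in (P', add_box Q (LEAST i. row_len P' i \<noteq> row_len P i) q))"

text \<open>
  An \<open>m \<times> n\<close> matrix over the natural numbers is identified with the exponent vector of its
  monomial: a finitely supported function on pairs, with support in \<open>{1..m} \<times> {1..n}\<close>.
\<close>

type_synonym expo = "(nat \<times> nat) \<Rightarrow>\<^sub>0 nat"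

definition biletters :: "nat \<Rightarrow> nat \<Rightarrow> expo \<Rightarrow> (nat \<times> nat) list" where
  "biletters m n \<alpha> =
     concat (map (\<lambda>j.
       concat (map (\<lambda>i. replicate (Poly_Mapping.lookup \<alpha> (i, j)) (i, j)) [1..<Suc m]))
       [1..<Suc n])"

definition RSK :: "nat \<Rightarrow> nat \<Rightarrow> expo \<Rightarrow> tableau \<times> tableau" where
  "RSK m n \<alpha> = fold insert_biletter (biletters m n \<alpha>) ([], [])"


section \<open>The RSK operator\<close>

text \<open>
  Polynomials in the variables \<open>z\<^bsub>ij\<^esub>\<close>; the ring \<open>R\<^bsub>m,n\<^esub>\<close> consists of those whose monomials
  have exponent vectors supported in \<open>{1..m} \<times> {1..n}\<close>.
\<close>

type_synonym zpoly = "expo \<Rightarrow>\<^sub>0 complex"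

definition zmonom :: "expo \<Rightarrow> zpoly" where
  "zmonom \<alpha> = Poly_Mapping.single \<alpha> 1"

definition zvar :: "nat \<Rightarrow> nat \<Rightarrow> zpoly" where
  "zvar i j = zmonom (Poly_Mapping.single (i, j) 1)"

definition minor :: "nat list \<Rightarrow> nat list \<Rightarrow> zpoly" where
  "minor is js = det (mat (length is) (length js) (\<lambda>(a, b). zvar (is ! a) (js ! b)))"

definition tab_column :: "tableau \<Rightarrow> nat \<Rightarrow> nat list" where
  "tab_column T c = map (\<lambda>r. r ! c) (filter (\<lambda>r. c < length r) T)"

text \<open>The \<open>0\<close>-th row is the longest one, so its length is the number of columns.\<close>

definition bitableau :: "tableau \<Rightarrow> tableau \<Rightarrow> zpoly" where
  "bitableau P Q = (\<Prod>c<row_len P 0. minor (tab_column P c) (tab_column Q c))"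

text \<open>
  The linear extension of \<open>z\<^sup>\<alpha> \<mapsto> [P|Q]\<close>; multiplication by \<open>single 0 c\<close> is multiplication by
  the scalar \<open>c\<close>.
\<close>

definition RSK_op :: "nat \<Rightarrow> nat \<Rightarrow> zpoly \<Rightarrow> zpoly" where
  "RSK_op m n f =
     (\<Sum>\<alpha>\<in>Poly_Mapping.keys f.
        Poly_Mapping.single 0 (Poly_Mapping.lookup f \<alpha>) *
        (case RSK m n \<alpha> of (P, Q) \<Rightarrow> bitableau P Q))"


section \<open>Weight spaces\<close>

text \<open>
  A vector of length \<open>m\<close> over the natural numbers is a finitely supported function with support
  in \<open>{1..m}\<close>.
\<close>

type_synonym weight = "nat \<Rightarrow>\<^sub>0 nat"

definition weight_pairs :: "nat \<Rightarrow> nat \<Rightarrow> nat \<Rightarrow> (weight \<times> weight) set" where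
  "weight_pairs m n d = {(\<sigma>, \<pi>).
     Poly_Mapping.keys \<sigma> \<subseteq> {1..m} \<and> Poly_Mapping.keys \<pi> \<subseteq> {1..n} \<and>
     (\<Sum>i=1..m. Poly_Mapping.lookup \<sigma> i) = d \<and> (\<Sum>j=1..n. Poly_Mapping.lookup \<pi> j) = d}"

definition Cont :: "nat \<Rightarrow> nat \<Rightarrow> weight \<Rightarrow> weight \<Rightarrow> expo set" where
  "Cont m n \<sigma> \<pi> = {\<alpha>.
     Poly_Mapping.keys \<alpha> \<subseteq> {1..m} \<times> {1..n} \<and>
     (\<forall>i\<in>{1..m}. (\<Sum>j=1..n. Poly_Mapping.lookup \<alpha> (i, j)) = Poly_Mapping.lookup \<sigma> i) \<and>
     (\<forall>j\<in>{1..n}. (\<Sum>i=1..m. Poly_Mapping.lookup \<alpha> (i, j)) = Poly_Mapping.lookup \<pi> j)}"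

text \<open>
  \<open>lex_greater \<alpha> \<beta>\<close> means \<open>z\<^sup>\<alpha> > z\<^sup>\<beta>\<close>: at the largest variable whose exponents in \<open>\<alpha>\<close> and \<open>\<beta>\<close>
  differ, \<open>\<alpha>\<close> has the larger one.
\<close>

definition var_greater :: "nat \<times> nat \<Rightarrow> nat \<times> nat \<Rightarrow> bool" where
  "var_greater = (\<lambda>(i, j) (i', j'). j < j' \<or> j = j' \<and> i < i')"

definition lex_greater :: "expo \<Rightarrow> expo \<Rightarrow> bool" where
  "lex_greater \<alpha> \<beta> \<longleftrightarrow>
     (\<exists>v. Poly_Mapping.lookup \<beta> v < Poly_Mapping.lookup \<alpha> v \<and>
       (\<forall>u. var_greater u v \<longrightarrow> Poly_Mapping.lookup \<alpha> u = Poly_Mapping.lookup \<beta> u))"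

text \<open>
  The set \<open>Cont m n \<sigma> \<pi>\<close> listed in decreasing lexicographic order; this determines the list,
  see \<open>Cont_list_unique\<close> and \<open>Cont_list\<close> below.
\<close>

definition Cont_list :: "nat \<Rightarrow> nat \<Rightarrow> weight \<Rightarrow> weight \<Rightarrow> expo list" where
  "Cont_list m n \<sigma> \<pi> = (THE as. set as = Cont m n \<sigma> \<pi> \<and> sorted_wrt lex_greater as)"

definition RSK_matrix :: "nat \<Rightarrow> nat \<Rightarrow> weight \<Rightarrow> weight \<Rightarrow> complex mat" where
  "RSK_matrix m n \<sigma> \<pi> =
     (let as = Cont_list m n \<sigma> \<pi>
      in mat (length as) (length as)
           (\<lambda>(b, a). Poly_Mapping.lookup (RSK_op m n (zmonom (as ! a))) (as ! b)))"


section \<open>The variable-multiplication weight poset\<close>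

definition wp_cover :: "nat \<Rightarrow> nat \<Rightarrow> weight \<times> weight \<Rightarrow> weight \<times> weight \<Rightarrow> bool" where
  "wp_cover m n x y \<longleftrightarrow>
     (\<exists>\<sigma> \<pi> d k l. x = (\<sigma>, \<pi>) \<and> (\<sigma>, \<pi>) \<in> weight_pairs m n d \<and> k \<in> {1..m} \<and> l \<in> {1..n} \<and>
        d \<le> Poly_Mapping.lookup \<sigma> k + Poly_Mapping.lookup \<pi> l \<and>
        y = (\<sigma> + Poly_Mapping.single k 1, \<pi> + Poly_Mapping.single l 1))"

definition wp_le :: "nat \<Rightarrow> nat \<Rightarrow> weight \<times> weight \<Rightarrow> weight \<times> weight \<Rightarrow> bool" where
  "wp_le m n = (wp_cover m n)\<^sup>*\<^sup>*"

definition wp_component :: "nat \<Rightarrow> nat \<Rightarrow> weight \<times> weight \<Rightarrow> (weight \<times> weight) set" where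
  "wp_component m n x = {y. equivclp (wp_le m n) x y}"

definition wp_reduced :: "nat \<Rightarrow> nat \<Rightarrow> weight \<times> weight \<Rightarrow> bool" where
  "wp_reduced m n x \<longleftrightarrow>
     (\<exists>d. x \<in> weight_pairs m n d) \<and> (\<forall>y. wp_le m n y x \<longrightarrow> y = x)"

definition wp_reduction :: "nat \<Rightarrow> nat \<Rightarrow> weight \<times> weight \<Rightarrow> weight \<times> weight" where
  "wp_reduction m n x = (THE y. y \<in> wp_component m n x \<and> wp_reduced m n y)"


section \<open>The monomial order determines the list\<close>

lemma finite_Cont: "finite (Cont m n \<sigma> \<pi>)"
proof -
  let ?B = "{1..m} \<times> {1..n}"
  let ?M = "\<Sum>i=1..m. Poly_Mapping.lookup \<sigma> i"
  have "Poly_Mapping.lookup \<alpha> v \<le> ?M" if h: "\<alpha> \<in> Cont m n \<sigma> \<pi>" "v \<in> ?B" for \<alpha> v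
  proof -
    obtain i j where v: "v = (i, j)" "i \<in> {1..m}" "j \<in> {1..n}" using h(2) by auto
    have "Poly_Mapping.lookup \<alpha> (i, j) \<le> (\<Sum>j=1..n. Poly_Mapping.lookup \<alpha> (i, j))"
      using v by (intro member_le_sum) auto
    also have "\<dots> = Poly_Mapping.lookup \<sigma> i" using h(1) v by (auto simp: Cont_def)
    also have "\<dots> \<le> ?M" using v by (intro member_le_sum) auto
    finally show ?thesis using v by simp
  qed
  then have "(\<lambda>\<alpha>. restrict (Poly_Mapping.lookup \<alpha>) ?B) ` Cont m n \<sigma> \<pi> \<subseteq> (\<Pi>\<^sub>E v\<in>?B. {..?M})"
    by (intro image_subsetI) (auto simp: restrict_PiE_iff)
  then have "finite ((\<lambda>\<alpha>. restrict (Poly_Mapping.lookup \<alpha>) ?B) ` Cont m n \<sigma> \<pi>)"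
    by (rule finite_subset) (intro finite_PiE, auto)
  moreover have "inj_on (\<lambda>\<alpha>. restrict (Poly_Mapping.lookup \<alpha>) ?B) (Cont m n \<sigma> \<pi>)"
  proof (rule inj_onI)
    fix \<alpha> \<beta>
    assume a: "\<alpha> \<in> Cont m n \<sigma> \<pi>" and b: "\<beta> \<in> Cont m n \<sigma> \<pi>"
      and eq: "restrict (Poly_Mapping.lookup \<alpha>) ?B = restrict (Poly_Mapping.lookup \<beta>) ?B"
    show "\<alpha> = \<beta>"
    proof (rule poly_mapping_eqI)
      fix v
      show "Poly_Mapping.lookup \<alpha> v = Poly_Mapping.lookup \<beta> v"
      proof (cases "v \<in> ?B")
        case True
        then show ?thesis using fun_cong[OF eq, of v] by (simp add: restrict_def)
      next
        case False
        then have "v \<notin> Poly_Mapping.keys \<alpha>" "v \<notin> Poly_Mapping.keys \<beta>"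
          using a b by (auto simp: Cont_def)
        then show ?thesis by (simp add: in_keys_iff)
      qed
    qed
  qed
  ultimately show ?thesis by (rule finite_imageD)
qed

lemma lex_greater_irrefl: "\<not> lex_greater \<alpha> \<alpha>"
  by (auto simp: lex_greater_def)

lemma var_greater_total: "u = v \<or> var_greater u v \<or> var_greater v u"
  by (cases u; cases v) (auto simp: var_greater_def)

lemma var_greater_trans: "var_greater u v \<Longrightarrow> var_greater v w \<Longrightarrow> var_greater u w"
  by (cases u; cases v; cases w) (auto simp: var_greater_def)

lemma lex_greater_trans:
  assumes "lex_greater \<alpha> \<beta>" "lex_greater \<beta> \<gamma>"
  shows "lex_greater \<alpha> \<gamma>"
proof -
  obtain u where u: "Poly_Mapping.lookup \<beta> u < Poly_Mapping.lookup \<alpha> u"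
    "\<And>w. var_greater w u \<Longrightarrow> Poly_Mapping.lookup \<alpha> w = Poly_Mapping.lookup \<beta> w"
    using assms(1) by (auto simp: lex_greater_def)
  obtain v where v: "Poly_Mapping.lookup \<gamma> v < Poly_Mapping.lookup \<beta> v"
    "\<And>w. var_greater w v \<Longrightarrow> Poly_Mapping.lookup \<beta> w = Poly_Mapping.lookup \<gamma> w"
    using assms(2) by (auto simp: lex_greater_def)
  consider "u = v" | "var_greater u v" | "var_greater v u" using var_greater_total by blast
  then show ?thesis
  proof cases
    case 1
    then have "Poly_Mapping.lookup \<gamma> u < Poly_Mapping.lookup \<alpha> u" using u(1) v(1) by simp
    then show ?thesis using u(2) v(2) 1 unfolding lex_greater_def by metis
  next
    case 2
    then have "Poly_Mapping.lookup \<gamma> u < Poly_Mapping.lookup \<alpha> u" using u(1) v(2) by metis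
    then show ?thesis using u(2) v(2) 2 var_greater_trans unfolding lex_greater_def by metis
  next
    case 3
    then have "Poly_Mapping.lookup \<gamma> v < Poly_Mapping.lookup \<alpha> v" using u(2) v(1) by metis
    then show ?thesis using u(2) v(2) 3 var_greater_trans unfolding lex_greater_def by metis
  qed
qed

lemma lex_greater_total:
  assumes "\<alpha> \<noteq> \<beta>"
  shows "lex_greater \<alpha> \<beta> \<or> lex_greater \<beta> \<alpha>"
proof -
  let ?D = "\<lambda>i j. Poly_Mapping.lookup \<alpha> (i, j) \<noteq> Poly_Mapping.lookup \<beta> (i, j)"
  have ex: "\<exists>j i. ?D i j" using assms by (metis poly_mapping_eqI surj_pair)
  define j where "j = (LEAST j. \<exists>i. ?D i j)"
  have j: "\<exists>i. ?D i j" unfolding j_def using ex by (rule LeastI_ex)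
  define i where "i = (LEAST i. ?D i j)"
  have ij: "?D i j" unfolding i_def using j by (rule LeastI_ex)
  have eq: "Poly_Mapping.lookup \<alpha> u = Poly_Mapping.lookup \<beta> u" if "var_greater u (i, j)" for u
  proof -
    obtain i' j' where u: "u = (i', j')" by (cases u)
    then consider "j' < j" | "j' = j" "i' < i" using \<open>var_greater u (i, j)\<close>
      by (auto simp: var_greater_def)
    then show ?thesis
    proof cases
      case 1
      then show ?thesis using not_less_Least[of j' "\<lambda>j. \<exists>i. ?D i j"] u by (auto simp: j_def)
    next
      case 2
      then show ?thesis using not_less_Least[of i' "\<lambda>i. ?D i j"] u by (auto simp: i_def)
    qed
  qed
  show ?thesis
  proof (cases "Poly_Mapping.lookup \<beta> (i, j) < Poly_Mapping.lookup \<alpha> (i, j)")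
    case True
    then show ?thesis using eq unfolding lex_greater_def by blast
  next
    case False
    then have "Poly_Mapping.lookup \<alpha> (i, j) < Poly_Mapping.lookup \<beta> (i, j)" using ij by simp
    then show ?thesis using eq unfolding lex_greater_def by metis
  qed
qed

lemma Cont_list_unique: "\<exists>!as. set as = Cont m n \<sigma> \<pi> \<and> sorted_wrt lex_greater as"
proof -
  let ?le = "\<lambda>\<alpha> \<beta>. \<alpha> = \<beta> \<or> lex_greater \<alpha> \<beta>"
  interpret L: linorder ?le lex_greater
    using lex_greater_irrefl lex_greater_trans lex_greater_total
    by unfold_locales blast+
  show ?thesis
    using L.finite_sorted_distinct_unique[OF finite_Cont[of m n \<sigma> \<pi>]]
    by (simp add: L.strict_sorted_iff)
qed

lemma Cont_list:
  "set (Cont_list m n \<sigma> \<pi>) = Cont m n \<sigma> \<pi>"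
  "sorted_wrt lex_greater (Cont_list m n \<sigma> \<pi>)"
  using theI'[OF Cont_list_unique[of m n \<sigma> \<pi>]] by (auto simp: Cont_list_def)

end

theory Submission
  imports Defs "HOL-Library.Confluence"
begin

text \<open>
  Suppose \<open>\<sigma>\<^sub>k + \<pi>\<^sub>l \<ge> d\<close>. The biletters of \<open>\<alpha>\<close> form a word \<open>u v t\<close> with \<open>v\<close> the letters of
  column \<open>l\<close>, and the condition says that \<open>\<alpha>\<^bsub>kl\<^esub>\<close> is at least the number of letters other than
  \<open>k\<close> in \<open>u\<close> and \<open>t\<close>. Hence the copies of \<open>k\<close> in \<open>v\<close> bump everything larger than \<open>k\<close> out of
  the first row, so that one more copy is simply appended, and there remain enough copies of \<open>k\<close>
  in the first row to feed all later bumps: the two insertion processes only ever differ by one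
  extra \<open>k\<close> in the first row of \<open>P\<close> and one extra \<open>l\<close> in the first row of \<open>Q\<close>. The same condition
  lets these two entries be placed in a common new column of height one, which multiplies the
  bitableau by \<open>z\<^bsub>kl\<^esub>\<close>. Since multiplication by \<open>z\<^bsub>kl\<^esub>\<close> is an order-preserving bijection of the
  two monomial bases, the two matrices agree along every covering relation. Minimal elements are
  unique because the covering relations, read downwards, have the diamond property.
\<close>

section \<open>The first rows under insertion\<close>

text \<open>Since \<open>b\<close> is the smallest label above \<open>p\<close> and \<open>c\<close>
  is its leftmost position, the labels left of \<open>c\<close> are at most \<open>p\<close> and
  those right of \<open>c\<close> at least \<open>b\<close>. The multiset form lets later arguments
  count labels instead of tracking positions.\<close>

lemma row_bump_sorted:
  fixes r :: "nat list"
  assumes r: "sorted r" and ex: "\<not> (\<forall>x\<in>set r. x \<le> p)"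
  defines "b \<equiv> Min {x \<in> set r. p < x}"
  defines "c \<equiv> LEAST c. c < length r \<and> r ! c = b"
  shows "b \<in> set r" "p < b" "sorted (r[c := p])" "mset (r[c := p]) = add_mset p (mset r - {#b#})"
proof -
  have "b \<in> {x \<in> set r. p < x}"
    unfolding b_def using ex by (intro Min_in) auto
  then show b: "b \<in> set r" "p < b" by auto
  have min: "b \<le> x" if "x \<in> set r" "p < x" for x
    unfolding b_def using that by (intro Min_le) auto
  have "c < length r \<and> r ! c = b"
    unfolding c_def by (rule LeastI_ex) (use b(1) in \<open>auto simp: in_set_conv_nth\<close>)
  then have c: "c < length r" "r ! c = b" by auto
  show "mset (r[c := p]) = add_mset p (mset r - {#b#})"
    using mset_update[OF c(1), of p] unfolding c(2) .
  have before: "r ! i \<le> p" if "i < c" for i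
  proof (rule ccontr)
    assume "\<not> r ! i \<le> p"
    then have "b \<le> r ! i" using min c that by simp
    moreover have "r ! i \<le> b" using sorted_nth_mono[OF r, of i c] c that by simp
    ultimately show False
      using not_less_Least[OF that[unfolded c_def]] that c by simp
  qed
  have after: "p \<le> r ! i" if "c < i" "i < length r" for i
    using sorted_nth_mono[OF r, of c i] c that b(2) by simp
  show "sorted (r[c := p])"
    unfolding sorted_iff_nth_mono
  proof (intro allI impI)
    fix i j
    assume "i \<le> j" "j < length (r[c := p])"
    then show "r[c := p] ! i \<le> r[c := p] ! j"
      using sorted_nth_mono[OF r, of i j] before[of i] after[of j] c(1)
      by (cases "i = c"; cases "j = c") auto
  qed
qed

lemma row_len_Cons: "row_len (x # xs) 0 = length x" "row_len (x # xs) (Suc i) = row_len xs i"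
  by (simp_all add: row_len_def)

text \<open>Guarantees that the \<open>LEAST\<close> in \<open>insert_biletter\<close> has a
  witness, which is needed to shift that index by one in
  \<open>insert_biletter_bump\<close>.\<close>

lemma row_insert_changes_shape: "\<exists>i. row_len (row_insert P p) i \<noteq> row_len P i"
proof (induction P p rule: row_insert.induct)
  case (1 p)
  show ?case by (rule exI[of _ 0]) (simp add: row_len_def)
next
  case (2 r rs p)
  show ?case
  proof (cases "\<forall>x\<in>set r. x \<le> p")
    case True
    then show ?thesis by (intro exI[of _ 0]) (simp add: row_len_def)
  next
    case False
    then obtain i where "row_len (row_insert rs (Min {x \<in> set r. p < x})) i \<noteq> row_len rs i"
      using 2 by blast
    with False show ?thesis by (intro exI[of _ "Suc i"]) (auto simp: row_len_Cons Let_def)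
  qed
qed

lemma insert_biletter_append:
  assumes "\<forall>x\<in>set r. x \<le> p"
  shows "insert_biletter (p, q) (r # rs, y # ys) = ((r @ [p]) # rs, (y @ [q]) # ys)"
proof -
  have "(LEAST i. row_len ((r @ [p]) # rs) i \<noteq> row_len (r # rs) i) = 0"
    by (intro Least_equality) (auto simp: row_len_def)
  with assms show ?thesis by (simp add: insert_biletter_def add_box_def Let_def)
qed

text \<open>A bump keeps the length of the first row, so the first changed row lies one below the
  first changed row of the remaining tableau. Thus the recording tableau recurses in step with
  \<open>P\<close>.\<close>

lemma insert_biletter_bump:
  assumes "\<not> (\<forall>x\<in>set r. x \<le> p)"
  defines "b \<equiv> Min {x \<in> set r. p < x}"
  shows "insert_biletter (p, q) (r # rs, y # ys) =
    (case insert_biletter (b, q) (rs, ys) of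
       (rs', ys') \<Rightarrow> (r[(LEAST c. c < length r \<and> r ! c = b) := p] # rs', y # ys'))"
proof -
  define r' where "r' = r[(LEAST c. c < length r \<and> r ! c = b) := p]"
  have ins: "row_insert (r # rs) p = r' # row_insert rs b"
    using assms(1) by (auto simp: b_def r'_def Let_def)
  have 0: "row_len (r' # row_insert rs b) 0 = row_len (r # rs) 0"
    by (simp add: row_len_Cons r'_def)
  obtain i where "row_len (row_insert rs b) i \<noteq> row_len rs i"
    using row_insert_changes_shape by blast
  then have "(LEAST i. row_len (r' # row_insert rs b) i \<noteq> row_len (r # rs) i)
      = Suc (LEAST i. row_len (row_insert rs b) i \<noteq> row_len rs i)"
    using Least_Suc[of "\<lambda>i. row_len (r' # row_insert rs b) i \<noteq> row_len (r # rs) i" "Suc i"] 0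
    by (simp add: row_len_Cons)
  then show ?thesis
    by (simp add: insert_biletter_def ins add_box_def Let_def del: row_insert.simps flip: r'_def)
qed

lemma insert_biletter_cases:
  assumes "sorted r"
  obtains (append) "\<forall>x\<in>set r. x \<le> p"
      "insert_biletter (p, q) (r # rs, y # ys) = ((r @ [p]) # rs, (y @ [q]) # ys)"
  | (bump) b r' rs' ys' where "b = Min {x \<in> set r. p < x}" "b \<in> set r" "p < b" "sorted r'"
      "mset r' = add_mset p (mset r - {#b#})" "insert_biletter (b, q) (rs, ys) = (rs', ys')"
      "insert_biletter (p, q) (r # rs, y # ys) = (r' # rs', y # ys')"
proof (cases "\<forall>x\<in>set r. x \<le> p")
  case True
  then show ?thesis using insert_biletter_append append by blast
next
  case False
  obtain rs' ys' where ins: "insert_biletter (Min {x \<in> set r. p < x}, q) (rs, ys) = (rs', ys')"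
    by fastforce
  show ?thesis
    using bump[OF refl row_bump_sorted[OF assms False] ins] insert_biletter_bump[OF False] ins
    by simp
qed

lemma sum_list_length_insert_biletter:
  assumes "insert_biletter (p, q) (P, Q) = (P', Q')"
  shows "sum_list (map length P') = Suc (sum_list (map length P))"
    "sum_list (map length Q') = Suc (sum_list (map length Q))"
proof -
  have "sum_list (map length (row_insert P p)) = Suc (sum_list (map length P))"
    by (induction P p rule: row_insert.induct) (auto simp: Let_def)
  moreover have "sum_list (map length (add_box Q i q)) = Suc (sum_list (map length Q))" for i
    using elem_le_sum_list[of i "map length Q"]
    by (auto simp: add_box_def map_update sum_list_update)
  ultimately show "sum_list (map length P') = Suc (sum_list (map length P))"
    "sum_list (map length Q') = Suc (sum_list (map length Q))"
    using assms by (auto simp: insert_biletter_def Let_def)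
qed

section \<open>First rows of \<open>P\<close> and \<open>Q\<close> after inserting a whole
  word\<close>

abbreviation count_le :: "nat \<Rightarrow> nat list \<Rightarrow> nat" where
  "count_le x r \<equiv> size {#a \<in># mset r. a \<le> x#}"

text \<open>Lower rows are hidden because the estimates concern first rows only. Insertion starts
  from \<open>([[]], [[]])\<close>, so that a first row is present even for the empty word.\<close>

definition first_rows :: "tableau \<times> tableau \<Rightarrow> nat list \<Rightarrow> nat list \<Rightarrow> bool" where
  "first_rows S r y \<longleftrightarrow> (\<exists>rs ys. S = (r # rs, y # ys)) \<and> sorted r"

text \<open>The truncated subtraction covers both cases: appending happens when no label exceeds
  \<open>p\<close>, and a bump trades exactly one larger label for \<open>p\<close>.\<close>

lemma first_rows_step:
  assumes "first_rows S r y"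
  obtains r' y' where "first_rows (insert_biletter (p, q) S) r' y'"
    "count_le p r' = Suc (count_le p r)"
    "count (mset r') p = Suc (count (mset r) p)"
    "size {#a \<in># mset r'. p < a#} = size {#a \<in># mset r. p < a#} - 1"
    "y' = y \<or> y' = y @ [q]"
proof -
  obtain rs ys where S: "S = (r # rs, y # ys)" and r: "sorted r"
    using assms by (auto simp: first_rows_def)
  from r show thesis
  proof (cases rule: insert_biletter_cases[of r p q rs y ys])
    case append
    have 0: "{#a \<in># mset r. p < a#} = {#}" using append(1) by auto
    show ?thesis
      by (rule that[of "r @ [p]" "y @ [q]"])
        (use append r S in \<open>auto simp: first_rows_def sorted_append 0\<close>)
  next
    case (bump b r' rs' ys')
    obtain A where A: "mset r = add_mset b A"
      using bump(2) by (metis mset_add set_mset_mset)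
    have r': "mset r' = add_mset p A" using bump(5) A by simp
    show ?thesis
      by (intro that[of r' y]) (use bump r S A r' in \<open>auto simp: first_rows_def\<close>)
  qed
qed

text \<open>The last clause holds because each inserted \<open>k\<close> adds one label at most
  \<open>k\<close>, and every other bump replaces a label by a smaller one. The row \<open>y\<close>
  stays sorted because recorded labels arrive in weakly increasing order.\<close>

lemma first_rows_fold:
  assumes "sorted (map snd w)"
  obtains r y rs ys where "fold insert_biletter w ([[]], [[]]) = (r # rs, y # ys)"
    "sorted r" "sorted y" "length r = length y"
    "mset r \<subseteq># mset (map fst w)" "mset y \<subseteq># mset (map snd w)"
    "length r + sum_list (map length rs) = length w"
    "length y + sum_list (map length ys) = length w"
    "\<And>k. count (mset (map fst w)) k \<le> count_le k r"
  using assms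
proof (induction w arbitrary: thesis rule: rev_induct)
  case Nil
  then show ?case by simp
next
  case (snoc a w)
  obtain p q where a: "a = (p, q)" by fastforce
  have "sorted (map snd w)" using snoc.prems by (simp add: sorted_append)
  from snoc.IH[OF _ this] obtain r y rs ys
    where IH: "fold insert_biletter w ([[]], [[]]) = (r # rs, y # ys)"
    "sorted r" "sorted y" "length r = length y"
    "mset r \<subseteq># mset (map fst w)" "mset y \<subseteq># mset (map snd w)"
    "length r + sum_list (map length rs) = length w"
    "length y + sum_list (map length ys) = length w"
    "\<And>k. count (mset (map fst w)) k \<le> count_le k r" by blast
  have y: "x \<le> q" if "x \<in> set y" for x
    using that set_mset_mono[OF IH(6)] snoc.prems(2) a by (fastforce simp: sorted_append)
  from IH(2) show ?case
  proof (cases rule: insert_biletter_cases[of r p q rs y ys])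
    case append
    show ?thesis
      by (rule snoc.prems(1)[of "r @ [p]" rs "y @ [q]" ys])
        (use append IH y in \<open>auto simp: a sorted_append le_SucI\<close>)
  next
    case (bump b r' rs' ys')
    obtain A where A: "mset r = add_mset b A"
      using bump(2) by (metis mset_add set_mset_mset)
    have r': "mset r' = add_mset p A" using bump(5) A by simp
    have len: "length r' = length r"
      using arg_cong[OF A, of size] arg_cong[OF r', of size] by simp
    have cnt: "count (mset (map fst (w @ [a]))) k \<le> count_le k r'" for k
      using IH(9)[of k] bump(3) by (auto simp: a A r' split: if_splits)
    have sub: "mset r' \<subseteq># mset (map fst (w @ [a]))"
      using subset_mset.order_trans[OF _ IH(5), of A] by (simp add: r' A a)
    have suby: "mset y \<subseteq># mset (map snd (w @ [a]))"
      using subset_mset.order_trans[OF IH(6)] by simp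
    show ?thesis
      by (rule snoc.prems(1)[OF _ bump(4) IH(3) _ sub suby _ _ cnt, of rs' ys'])
        (use bump(7) IH(1,4,7,8) len sum_list_length_insert_biletter[OF bump(6)] in \<open>simp_all add: a\<close>)
  qed
qed

lemma first_rows_unique: "first_rows S r y \<Longrightarrow> first_rows S r' y' \<Longrightarrow> r' = r \<and> y' = y"
  by (auto simp: first_rows_def)

lemma first_rows_fold_extends:
  assumes "first_rows S r y"
  obtains r' z where "first_rows (fold insert_biletter w S) r' (y @ z)"
proof -
  have "\<exists>r' z. first_rows (fold insert_biletter w S) r' (y @ z)"
  proof (induction w rule: rev_induct)
    case Nil
    show ?case by (rule exI[of _ r], rule exI[of _ "[]"]) (simp add: assms)
  next
    case (snoc a w)
    obtain p q where a: "a = (p, q)" by fastforce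
    obtain r' z where IH: "first_rows (fold insert_biletter w S) r' (y @ z)" using snoc by blast
    obtain r2 y2 where "first_rows (insert_biletter (p, q) (fold insert_biletter w S)) r2 y2"
      "y2 = y @ z \<or> y2 = (y @ z) @ [q]"
      using first_rows_step[OF IH] by metis
    then have "first_rows (fold insert_biletter (w @ [a]) S) r2 (y @ z) \<or>
        first_rows (fold insert_biletter (w @ [a]) S) r2 (y @ (z @ [q]))"
      using a by auto
    then show ?case by blast
  qed
  with that show thesis by blast
qed

lemma size_filter_mset_mono:
  "(\<And>a. P a \<Longrightarrow> Q a) \<Longrightarrow> size (filter_mset P A) \<le> size (filter_mset Q A)"
  by (induction A) (auto intro: le_SucI)

text \<open>Each letter \<open>p\<close> of the weakly increasing word raises the number of labels
  at most \<open>p\<close> by one, and all earlier letters were already counted as at most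
  \<open>p\<close>.\<close>

lemma first_rows_fold_sorted:
  assumes "first_rows S r y" "sorted (map fst v)"
  obtains r' y' where "first_rows (fold insert_biletter v S) r' y'" "length v \<le> length r'"
proof -
  \<comment> \<open>The bound is proved for every upper bound \<open>x\<close> of the letters read,
    since the next letter is itself such a bound for the preceding ones.\<close>
  have "\<exists>r' y'. first_rows (fold insert_biletter v S) r' y' \<and>
      (\<forall>x. (\<forall>a\<in>set v. fst a \<le> x) \<longrightarrow> length v \<le> count_le x r')"
    using assms(2)
  proof (induction v rule: rev_induct)
    case Nil
    then show ?case using assms(1) by auto
  next
    case (snoc a v)
    obtain p q where a: "a = (p, q)" by fastforce
    obtain r' y' where IH: "first_rows (fold insert_biletter v S) r' y'"
      "\<And>x. (\<forall>a\<in>set v. fst a \<le> x) \<Longrightarrow> length v \<le> count_le x r'"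
      using snoc by (auto simp: sorted_append)
    obtain r2 y2 where 2: "first_rows (insert_biletter (p, q) (fold insert_biletter v S)) r2 y2"
      "count_le p r2 = Suc (count_le p r')"
      using first_rows_step[OF IH(1)] by metis
    have "length v \<le> count_le p r'"
      using snoc.prems a by (intro IH(2)) (auto simp: sorted_append)
    then have "length (v @ [a]) \<le> count_le x r2" if "p \<le> x" for x
      using 2(2) size_filter_mset_mono[of "\<lambda>a. a \<le> p" "\<lambda>a. a \<le> x" "mset r2"] that by simp
    then show ?case using 2(1) a by auto
  qed
  then obtain r' y' where r': "first_rows (fold insert_biletter v S) r' y'"
    "\<And>x. (\<forall>a\<in>set v. fst a \<le> x) \<Longrightarrow> length v \<le> count_le x r'" by blast
  \<comment> \<open>For empty \<open>v\<close> the value of \<open>Max\<close> is unspecified, but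
    the premise of \<open>r'(2)\<close> is then vacuous.\<close>
  have "length v \<le> count_le (Max (fst ` set v)) r'" by (intro r'(2)) auto
  also have "\<dots> \<le> length r'" by (metis size_filter_mset_lesseq size_mset)
  finally show thesis using r'(1) that by blast
qed

text \<open>After \<open>u @ v\<close> the first row of \<open>P\<close> has at least
  \<open>length v\<close> labels. That of \<open>Q\<close> is equally long with all labels at most
  \<open>l\<close>, and later letters only extend it. This is the counterpart for \<open>Q\<close>
  of the last clause of \<open>first_rows_fold\<close>.\<close>

lemma count_le_recording_row:
  assumes "fold insert_biletter (u @ v @ t) ([[]], [[]]) = (r # rs, y # ys)"
    and "sorted (map snd (u @ v))" "\<forall>a\<in>set (u @ v). snd a \<le> l" "sorted (map fst v)"
  shows "length v \<le> count_le l y"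
proof -
  have "first_rows ([[]], [[]]) [] []" by (simp add: first_rows_def)
  then obtain r0 y0 where 0: "first_rows (fold insert_biletter u ([[]], [[]])) r0 y0"
    by (rule first_rows_fold_extends)
  obtain r1 y1 where 1: "first_rows (fold insert_biletter (u @ v) ([[]], [[]])) r1 y1"
    "length v \<le> length r1"
    using first_rows_fold_sorted[OF 0 assms(4)] by auto
  obtain r2 y2 rs2 ys2 where 2: "fold insert_biletter (u @ v) ([[]], [[]]) = (r2 # rs2, y2 # ys2)"
    "sorted r2" "length r2 = length y2" "mset y2 \<subseteq># mset (map snd (u @ v))"
    using first_rows_fold[OF assms(2)] by metis
  have y1: "y1 = y2" "r1 = r2"
    using first_rows_unique[OF 1(1), of r2 y2] 2 by (auto simp: first_rows_def)
  have le: "x \<le> l" if "x \<in> set y1" for x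
    using that set_mset_mono[OF 2(4)] assms(3) y1 by auto
  obtain r3 z where 3: "first_rows (fold insert_biletter (u @ v @ t) ([[]], [[]])) r3 (y1 @ z)"
    using first_rows_fold_extends[OF 1(1), of t] unfolding fold_append comp_apply by metis
  have "y = y1 @ z" using 3 assms(1) by (auto simp: first_rows_def)
  moreover have "{#a \<in># mset y1. a \<le> l#} = mset y1"
    using le by (auto simp: filter_mset_eq_conv)
  ultimately show ?thesis using 1(2) 2(3) y1 by simp
qed

lemma fold_replicate_Suc: "fold f (replicate (Suc M) a) S = f a (fold f (replicate M a) S)"
  by (induction M arbitrary: S) auto

text \<open>Each copy of \<open>k\<close> bumps one label above \<open>k\<close> as long as there is
  one, and never displaces another copy of \<open>k\<close>.\<close>

lemma first_rows_replicate:
  assumes "first_rows S r y"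
  obtains r' y' where "first_rows (fold insert_biletter (replicate M (k, l)) S) r' y'"
    "M \<le> count (mset r') k" "size {#a \<in># mset r'. k < a#} = size {#a \<in># mset r. k < a#} - M"
  using assms
proof (induction M arbitrary: thesis)
  case 0
  then show ?case by auto
next
  case (Suc M)
  obtain r' y' where IH: "first_rows (fold insert_biletter (replicate M (k, l)) S) r' y'"
    "M \<le> count (mset r') k" "size {#a \<in># mset r'. k < a#} = size {#a \<in># mset r. k < a#} - M"
    using Suc.IH Suc.prems(2) by blast
  obtain r2 y2 where 2: "first_rows (insert_biletter (k, l)
      (fold insert_biletter (replicate M (k, l)) S)) r2 y2"
    "count (mset r2) k = Suc (count (mset r') k)"
    "size {#a \<in># mset r2. k < a#} = size {#a \<in># mset r'. k < a#} - 1"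
    using first_rows_step[OF IH(1)] by metis
  show ?case
    by (rule Suc.prems(1)[of r2 y2]) (use 2 IH in \<open>simp_all add: fold_replicate_Suc del: replicate.simps\<close>)
qed

section \<open>Inserting one more biletter\<close>

text \<open>Whenever the extra \<open>k\<close> could be a candidate for bumping, \<open>r\<close>
  already contains a \<open>k\<close>, so the bumped label and the lower rows do not notice the
  extra copy. The final bound records that only a letter below \<open>k\<close> can use up a
  copy.\<close>

lemma insert_biletter_extra:
  assumes r: "sorted r" "sorted r1" "mset r1 = add_mset k (mset r)"
    and k: "p < k \<Longrightarrow> k \<in> set r" and y: "mset y1 = add_mset l (mset y)"
  obtains r' rs' y' ys' r1' y1' where
    "insert_biletter (p, q) (r # rs, y # ys) = (r' # rs', y' # ys')"
    "insert_biletter (p, q) (r1 # rs, y1 # ys) = (r1' # rs', y1' # ys')"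
    "sorted r'" "sorted r1'" "mset r1' = add_mset k (mset r')" "mset y1' = add_mset l (mset y')"
    "count (mset r) k \<le> count (mset r') k + (if p < k then 1 else 0)"
proof -
  have "set r1 = insert k (set r)" using arg_cong[OF r(3), of set_mset] by simp
  \<comment> \<open>Both rows offer the same labels above \<open>p\<close>; hence either both append
    or both bump the same label.\<close>
  then have E: "{x \<in> set r1. p < x} = {x \<in> set r. p < x}" using k by auto
  from r(1) show thesis
  proof (cases rule: insert_biletter_cases[of r p q rs y ys])
    case append
    have le: "\<forall>x\<in>set r1. x \<le> p"
    proof
      fix x assume "x \<in> set r1"
      then show "x \<le> p" using E append(1) by (metis (no_types, lifting) mem_Collect_eq not_less)
    qed
    show ?thesis
      by (rule that[OF append(2) insert_biletter_append[OF le]])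
        (use append(1) le r y in \<open>auto simp: sorted_append\<close>)
  next
    case (bump b r' rs' ys')
    from r(2) show ?thesis
    proof (cases rule: insert_biletter_cases[of r1 p q rs y1 ys])
      case append
      have "b \<in> {x \<in> set r1. p < x}" unfolding E using bump(2,3) by simp
      then show ?thesis using append(1) by fastforce
    next
      case (bump b1 r1' rs1' ys1')
      have b1: "b1 = b" using \<open>b = _\<close> \<open>b1 = _\<close> E by simp
      obtain A where A: "mset r = add_mset b A"
        using \<open>b \<in> set r\<close> by (metis mset_add set_mset_mset)
      have r': "mset r' = add_mset p A"
        using A \<open>mset r' = _\<close> by simp
      have r1': "mset r1' = add_mset p (add_mset k A)"
        using A \<open>mset r1' = _\<close> r(3) b1 by (simp add: add_mset_commute)
      have "rs1' = rs'" "ys1' = ys'"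
        using \<open>insert_biletter (b, q) _ = _\<close> \<open>insert_biletter (b1, q) _ = _\<close> b1 by auto
      then show ?thesis
        using that[OF \<open>insert_biletter (p, q) (r # rs, y # ys) = _\<close>, of r1' y1]
          \<open>insert_biletter (p, q) (r1 # rs, y1 # ys) = _\<close> \<open>sorted r'\<close> \<open>sorted r1'\<close>
          r' r1' y A \<open>p < b\<close> by auto
    qed
  qed
qed

text \<open>The last hypothesis is a budget: each remaining letter below \<open>k\<close> removes at
  most one \<open>k\<close> from the row, so a copy is present whenever
  \<open>insert_biletter_extra\<close> asks for it.\<close>

lemma fold_insert_biletter_extra:
  assumes "sorted r" "sorted r1" "mset r1 = add_mset k (mset r)"
    and "mset y1 = add_mset l (mset y)"
    and "size {#a \<in># mset (map fst w). a < k#} \<le> count (mset r) k"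
  obtains r' rs' y' ys' r1' y1' where
    "fold insert_biletter w (r # rs, y # ys) = (r' # rs', y' # ys')"
    "fold insert_biletter w (r1 # rs, y1 # ys) = (r1' # rs', y1' # ys')"
    "mset r1' = add_mset k (mset r')" "mset y1' = add_mset l (mset y')"
  using assms
proof (induction w arbitrary: r r1 rs y y1 ys thesis)
  case Nil
  then show ?case by simp
next
  case (Cons a w)
  obtain p q where a: "a = (p, q)" by fastforce
  have k: "k \<in> set r" if "p < k"
  proof -
    have "0 < count (mset r) k" using Cons.prems(6) that a by (simp add: Suc_le_eq del: count_greater_zero_iff)
    then show ?thesis by simp
  qed
  obtain r' rs' y' ys' r1' y1' where 1:
    "insert_biletter (p, q) (r # rs, y # ys) = (r' # rs', y' # ys')"
    "insert_biletter (p, q) (r1 # rs, y1 # ys) = (r1' # rs', y1' # ys')"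
    "sorted r'" "sorted r1'" "mset r1' = add_mset k (mset r')" "mset y1' = add_mset l (mset y')"
    "count (mset r) k \<le> count (mset r') k + (if p < k then 1 else 0)"
    using insert_biletter_extra[OF Cons.prems(2-4) k Cons.prems(5), where q = q and rs = rs and ys = ys]
    by metis
  have "size {#a \<in># mset (map fst w). a < k#} \<le> count (mset r') k"
    using Cons.prems(6) 1(7) a by (auto split: if_splits)
  from Cons.IH[OF _ 1(3-6) this, of rs' ys'] show ?case
    using Cons.prems(1) 1(1,2) a by (metis fold_simps(2))
qed

text \<open>The bound on \<open>u\<close> lets the \<open>M\<close> copies clear all labels above
  \<open>k\<close> from the first row; the bound on \<open>v\<close> is the budget for
  \<open>fold_insert_biletter_extra\<close>.\<close>

lemma fold_insert_biletter_replicate_Suc: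
  assumes w: "sorted (map snd (u @ replicate M (k, l) @ v))"
    and u: "size {#a \<in># mset (map fst u). k < a#} \<le> M"
    and v: "size {#a \<in># mset (map fst v). a < k#} \<le> M"
  obtains r rs y ys r1 y1 where
    "fold insert_biletter (u @ replicate M (k, l) @ v) ([[]], [[]]) = (r # rs, y # ys)"
    "fold insert_biletter (u @ replicate (Suc M) (k, l) @ v) ([[]], [[]]) = (r1 # rs, y1 # ys)"
    "mset r1 = add_mset k (mset r)" "mset y1 = add_mset l (mset y)"
proof -
  let ?S = "fold insert_biletter u ([[]], [[]])"
  obtain r0 rs0 y0 ys0 where 0: "?S = (r0 # rs0, y0 # ys0)" "sorted r0"
    "mset r0 \<subseteq># mset (map fst u)"
    using first_rows_fold[of u] w by (metis map_append sorted_append)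
  have "size {#a \<in># mset r0. k < a#} \<le> M"
    using size_mset_mono[OF multiset_filter_mono[OF 0(3)]] u order_trans by blast
  moreover have "first_rows ?S r0 y0" using 0 by (simp add: first_rows_def)
  ultimately obtain r1 y1 where 1: "first_rows (fold insert_biletter (replicate M (k, l)) ?S) r1 y1"
    "M \<le> count (mset r1) k" "size {#a \<in># mset r1. k < a#} = 0"
    using first_rows_replicate[of ?S r0 y0 M k l] by (metis diff_is_0_eq)
  obtain rs1 ys1 where S1: "fold insert_biletter (replicate M (k, l)) ?S = (r1 # rs1, y1 # ys1)"
    and r1: "sorted r1" using 1(1) by (auto simp: first_rows_def)
  \<comment> \<open>So the additional copy is appended and no lower row is touched.\<close>
  have le: "\<forall>x\<in>set r1. x \<le> k" using 1(3) by (auto simp: not_less)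
  have "fold insert_biletter (replicate (Suc M) (k, l)) ?S
      = insert_biletter (k, l) (r1 # rs1, y1 # ys1)"
    using S1 by (simp only: fold_replicate_Suc)
  then have S2: "fold insert_biletter (replicate (Suc M) (k, l)) ?S
      = ((r1 @ [k]) # rs1, (y1 @ [l]) # ys1)"
    by (simp only: insert_biletter_append[OF le])
  obtain r rs y ys r1' y1' where
    "fold insert_biletter v (r1 # rs1, y1 # ys1) = (r # rs, y # ys)"
    "fold insert_biletter v ((r1 @ [k]) # rs1, (y1 @ [l]) # ys1) = (r1' # rs, y1' # ys)"
    "mset r1' = add_mset k (mset r)" "mset y1' = add_mset l (mset y)"
    by (rule fold_insert_biletter_extra[of r1 "r1 @ [k]" k "y1 @ [l]" l y1 v rs1 ys1])
      (use r1 le 1(2) v in \<open>auto simp: sorted_append\<close>)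
  then show thesis
    using that[of r rs y ys r1' y1'] S1 S2 by (simp del: replicate.simps)
qed

text \<open>Any position after all labels below \<open>k\<close> and before all labels above
  \<open>k\<close> yields the same list. This freedom is what allows one position to serve two
  different rows.\<close>

lemma sorted_insert_at:
  assumes r: "sorted r" "sorted r1" "mset r1 = add_mset k (mset r)"
    and t: "size {#a \<in># mset r. a < k#} \<le> t" "t \<le> count_le k r"
  shows "r1 = take t r @ k # drop t r"
proof -
  \<comment> \<open>Otherwise all labels from position \<open>i\<close> on exceed \<open>k\<close>,
    which leaves at most \<open>i < t\<close> labels that are at most \<open>k\<close>.\<close>
  have le: "r ! i \<le> k" if i: "i < t" "i < length r" for i
  proof (rule ccontr)
    assume "\<not> r ! i \<le> k"
    have "\<not> a \<le> k" if a: "a \<in> set (drop i r)" for a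
    proof -
      obtain j where "j < length (drop i r)" "drop i r ! j = a"
        using a unfolding in_set_conv_nth by blast
      then have "a = r ! (i + j)" "i + j < length r" by auto
      then show ?thesis using sorted_nth_mono[OF r(1), of i "i + j"] \<open>\<not> r ! i \<le> k\<close> by simp
    qed
    then have "{#a \<in># mset (drop i r). a \<le> k#} = {#}" by auto
    then have "count_le k r = size {#a \<in># mset (take i r). a \<le> k#}"
      by (metis (no_types, lifting) add.right_neutral append_take_drop_id filter_union_mset mset_append)
    also have "\<dots> \<le> i" by (rule order_trans[OF size_filter_mset_lesseq]) simp
    finally show False using i t by simp
  qed
  \<comment> \<open>Dually, a label below \<open>k\<close> at position \<open>i\<close> gives at
    least \<open>Suc i > t\<close> labels below \<open>k\<close>.\<close>
  have ge: "k \<le> r ! i" if i: "t \<le> i" "i < length r" for i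
  proof (rule ccontr)
    assume "\<not> k \<le> r ! i"
    then have "a < k" if "a \<in> set (take (Suc i) r)" for a
      using that sorted_nth_mono[OF r(1), of _ i] i
      by (fastforce simp: in_set_conv_nth less_Suc_eq_le)
    then have "{#a \<in># mset (take (Suc i) r). a < k#} = mset (take (Suc i) r)"
      by (auto simp: filter_mset_eq_conv)
    then have "Suc i \<le> size {#a \<in># mset (take (Suc i) r @ drop (Suc i) r). a < k#}"
      using i by (simp del: append_take_drop_id)
    then show False using i t by simp
  qed
  have "sorted (take t r @ k # drop t r)"
    using r(1) le ge by (force simp: sorted_append in_set_conv_nth sorted_wrt_take sorted_wrt_drop
        intro: sorted_nth_mono)
  moreover have "mset (take t r @ k # drop t r) = mset r1"
    using r(3) mset_append[of "take t r" "drop t r"] by simp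
  ultimately show ?thesis using r(2) by (metis properties_for_sort sorted_sort_id)
qed

section \<open>The bitableau of the longer word\<close>

lemma tab_column_Cons:
  "tab_column (r # rs) c = (if c < length r then [r ! c] else []) @ tab_column rs c"
  by (simp add: tab_column_def)

lemma tab_column_beyond: "\<forall>r\<in>set rs. length r \<le> c \<Longrightarrow> tab_column rs c = []"
  by (auto simp: tab_column_def filter_empty_conv)

lemma minor_singleton: "minor [i] [j] = zvar i j"
  by (simp add: minor_def det_single)

text \<open>From position \<open>t\<close> on only the first rows have boxes. Columns before
  \<open>t\<close> are unchanged, the new column contributes a minor of size one, and the later
  columns move one place to the right.\<close>

lemma bitableau_insert_singleton_column:
  assumes t: "t \<le> length r" "length y = length r"
    and rs: "\<forall>x\<in>set rs. length x \<le> t" "\<forall>x\<in>set ys. length x \<le> t"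
  shows "bitableau ((take t r @ k # drop t r) # rs) ((take t y @ l # drop t y) # ys)
    = zvar k l * bitableau (r # rs) (y # ys)"
proof -
  let ?P = "(take t r @ k # drop t r) # rs" and ?Q = "(take t y @ l # drop t y) # ys"
  let ?f = "\<lambda>c. minor (tab_column ?P c) (tab_column ?Q c)"
  let ?g = "\<lambda>c. minor (tab_column (r # rs) c) (tab_column (y # ys) c)"
  have beyond: "tab_column rs c = []" "tab_column ys c = []" if "t \<le> c" for c
    using that rs by (force intro!: tab_column_beyond)+
  have low: "?f c = ?g c" if "c < t" for c
    using that t by (simp add: tab_column_Cons nth_append)
  have mid: "?f t = zvar k l"
    using t by (simp add: tab_column_Cons nth_append beyond minor_singleton)
  have high: "?f (Suc c) = ?g c" if "t \<le> c" "c < length r" for c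
    using that t by (simp add: tab_column_Cons nth_append beyond Suc_diff_le)
  have "{..<Suc (length r)} = {..<t} \<union> insert t (Suc ` {t..<length r})"
    using t(1) by auto
  moreover have "row_len ?P 0 = Suc (length r)" using t by (simp add: row_len_def)
  ultimately have "bitableau ?P ?Q = (\<Prod>c\<in>{..<t} \<union> insert t (Suc ` {t..<length r}). ?f c)"
    by (simp only: bitableau_def)
  also have "\<dots> = (\<Prod>c\<in>{..<t}. ?f c) * (?f t * (\<Prod>c\<in>{t..<length r}. ?f (Suc c)))"
  proof -
    have "t \<notin> Suc ` {t..<length r}" by auto
    then show ?thesis
      by (subst prod.union_disjoint) (auto simp: prod.reindex simp del: image_Suc_atLeastLessThan)
  qed
  also have "\<dots> = zvar k l * ((\<Prod>c\<in>{..<t}. ?g c) * (\<Prod>c\<in>{t..<length r}. ?g c))"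
    using low mid high by simp
  also have "(\<Prod>c\<in>{..<t}. ?g c) * (\<Prod>c\<in>{t..<length r}. ?g c) = (\<Prod>c<length r. ?g c)"
    using prod.atLeastLessThan_concat[of 0 t "length r" ?g] t by (simp add: lessThan_atLeast0)
  also have "\<dots> = bitableau (r # rs) (y # ys)" by (simp add: bitableau_def row_len_def)
  finally show ?thesis .
qed

text \<open>The first letter opens row 0 from either starting pair, which justifies starting with
  one empty row.\<close>

lemma fold_insert_biletter_Nil_rows:
  "w \<noteq> [] \<Longrightarrow> fold insert_biletter w ([], []) = fold insert_biletter w ([[]], [[]])"
proof (cases w)
  case (Cons a w')
  obtain p q where a: "a = (p, q)" by fastforce
  have "(LEAST i. row_len [[p]] i \<noteq> row_len [] i) = 0"
    by (intro Least_equality) (auto simp: row_len_def)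
  moreover have "(LEAST i. row_len [[p]] i \<noteq> row_len [[]] i) = 0"
    by (intro Least_equality) (auto simp: row_len_def)
  ultimately have "insert_biletter a ([], []) = insert_biletter a ([[]], [[]])"
    by (simp add: a insert_biletter_def add_box_def)
  then show ?thesis using Cons by simp
qed auto

definition word_bitableau :: "(nat \<times> nat) list \<Rightarrow> zpoly" where
  "word_bitableau w = (case fold insert_biletter w ([], []) of (P, Q) \<Rightarrow> bitableau P Q)"

text \<open>For the empty word the two results differ as pairs, but both products range over no
  columns.\<close>

lemma word_bitableau_eq:
  "word_bitableau w = (case fold insert_biletter w ([[]], [[]]) of (P, Q) \<Rightarrow> bitableau P Q)"
  by (cases "w = []")
     (simp_all add: word_bitableau_def fold_insert_biletter_Nil_rows bitableau_def row_len_def)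

lemma size_filter_less_le:
  assumes "mset r \<subseteq># mset w"
  shows "size {#a \<in># mset r. a < (k::nat)#} + count (mset w) k \<le> length w"
proof -
  have "size {#a \<in># mset r. a < k#} \<le> size {#a \<in># mset w. a < k#}"
    by (intro size_mset_mono multiset_filter_mono assms)
  also have "\<dots> + count (mset w) k \<le> length w"
    by (induction w) auto
  finally show ?thesis by simp
qed

text \<open>
  A common column position \<open>t\<close> for the two new entries exists since the intervals of admissible
  positions for \<open>k\<close> and \<open>l\<close> meet, beyond every column of height at least two.
\<close>

lemma word_bitableau_replicate_Suc:
  assumes sorted: "sorted (map snd (u @ v1 @ replicate M (k, l) @ v2 @ t))"
    and u: "\<forall>a\<in>set u. snd a < l" and v: "\<forall>a\<in>set (v1 @ v2). snd a = l"
    and t: "\<forall>a\<in>set t. l < snd a"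
    and v1: "\<forall>a\<in>set v1. fst a < k" and v2: "\<forall>a\<in>set v2. k < fst a"
    and sorted_v: "sorted (map fst (v1 @ v2))"
    and d: "length (u @ v1 @ replicate M (k, l) @ v2 @ t) \<le>
      count (mset (map fst (u @ v1 @ replicate M (k, l) @ v2 @ t))) k +
      count (mset (map snd (u @ v1 @ replicate M (k, l) @ v2 @ t))) l"
  shows "word_bitableau (u @ v1 @ replicate (Suc M) (k, l) @ v2 @ t)
    = zvar k l * word_bitableau (u @ v1 @ replicate M (k, l) @ v2 @ t)"
proof -
  let ?v = "v1 @ replicate M (k, l) @ v2"
  let ?w = "u @ v1 @ replicate M (k, l) @ v2 @ t"
  let ?w1 = "u @ v1 @ replicate (Suc M) (k, l) @ v2 @ t"
  let ?init = "([[]], [[]]) :: tableau \<times> tableau"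
  have cnt_l: "count (mset (map snd ?w)) l = length ?v"
  proof -
    have "count (mset (map snd u)) l = 0" "count (mset (map snd t)) l = 0"
      using u t by (auto simp: count_eq_zero_iff)
    moreover have "map snd ?v = replicate (length ?v) l"
      using v by (auto intro!: replicate_eqI simp: in_set_replicate)
    then have "count (mset (map snd ?v)) l = length ?v" by (metis count_mset count_replicate_mset mset_replicate)
    ultimately show ?thesis by simp
  qed
  have cnt: "size {#a \<in># mset (map fst x). P a#} + count (mset (map fst x)) k \<le> length x"
    if "\<not> P k" for P and x :: "(nat \<times> nat) list"
    using that by (induction x) auto
  have v0: "{#a \<in># image_mset fst (mset v1). k < a#} = {#}"
    "{#a \<in># image_mset fst (mset v2). a < k#} = {#}"
    "count (image_mset fst (mset v1)) k = 0" "count (image_mset fst (mset v2)) k = 0"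
    using v1 v2 by (auto simp: count_eq_zero_iff)
  \<comment> \<open>Neither \<open>v1\<close> nor \<open>v2\<close> contains \<open>k\<close>.
    Cancelling the column block in \<open>d\<close> therefore shows that at most \<open>M\<close>
    letters of \<open>u\<close> and \<open>t\<close> differ from \<open>k\<close>.\<close>
  have M: "size {#a \<in># mset (map fst u). k < a#} + size {#a \<in># mset (map fst t). a < k#} \<le> M"
    using d cnt_l v0(3,4) cnt[of "\<lambda>a. k < a" u] cnt[of "\<lambda>a. a < k" t] by simp
  \<comment> \<open>\<open>v1\<close> joins the prefix and \<open>v2\<close> the suffix; their
    letters lie on the side of \<open>k\<close> that the respective count ignores.\<close>
  have "sorted (map snd ((u @ v1) @ replicate M (k, l) @ v2 @ t))"
    "size {#a \<in># mset (map fst (u @ v1)). k < a#} \<le> M"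
    "size {#a \<in># mset (map fst (v2 @ t)). a < k#} \<le> M"
    using sorted M by (simp_all add: v0)
  note fold_insert_biletter_replicate_Suc[OF this, unfolded append_assoc]
  then obtain r rs y ys r1 y1 where
    w: "fold insert_biletter ?w ?init = (r # rs, y # ys)" and
    w1: "fold insert_biletter ?w1 ?init = (r1 # rs, y1 # ys)" and
    r1: "mset r1 = add_mset k (mset r)" "mset y1 = add_mset l (mset y)"
    by blast
  have "sorted (map snd ?w1)"
    using sorted u v t by (auto simp: sorted_append)
  then obtain r2 y2 rs2 ys2 where
    "fold insert_biletter ?w1 ?init = (r2 # rs2, y2 # ys2)" "sorted r2" "sorted y2"
    by (rule first_rows_fold)
  with w1 have sorted1: "sorted r1" "sorted y1" by simp_all
  have w_facts: "sorted r" "sorted y" "length r = length y"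
    "mset r \<subseteq># mset (map fst ?w)" "mset y \<subseteq># mset (map snd ?w)"
    "length r + sum_list (map length rs) = length ?w"
    "length y + sum_list (map length ys) = length ?w"
    "count (mset (map fst ?w)) k \<le> count_le k r"
  proof -
    obtain r' y' rs' ys' where "fold insert_biletter ?w ?init = (r' # rs', y' # ys')"
      "sorted r'" "sorted y'" "length r' = length y'"
      "mset r' \<subseteq># mset (map fst ?w)" "mset y' \<subseteq># mset (map snd ?w)"
      "length r' + sum_list (map length rs') = length ?w"
      "length y' + sum_list (map length ys') = length ?w"
      "\<And>k. count (mset (map fst ?w)) k \<le> count_le k r'"
      by (rule first_rows_fold[OF sorted]) blast
    moreover from this(1) have "r' = r" "rs' = rs" "y' = y" "ys' = ys" using w by simp_all
    ultimately show "sorted r" "sorted y" "length r = length y"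
      "mset r \<subseteq># mset (map fst ?w)" "mset y \<subseteq># mset (map snd ?w)"
      "length r + sum_list (map length rs) = length ?w"
      "length y + sum_list (map length ys) = length ?w"
      "count (mset (map fst ?w)) k \<le> count_le k r" by blast+
  qed
  have "sorted (map fst ?v)"
    using sorted_v v1 v2 by (auto simp: sorted_append less_imp_le)
  moreover have "sorted (map snd (u @ ?v) @ map snd t)"
    using sorted by (simp only: map_append append_assoc)
  then have "sorted (map snd (u @ ?v))" by (simp only: sorted_append)
  moreover have "\<forall>a\<in>set (u @ ?v). snd a \<le> l" using u v by (auto simp: less_imp_le)
  moreover have "fold insert_biletter (u @ ?v @ t) ?init = (r # rs, y # ys)"
    using w by (simp only: append_assoc)
  ultimately have Q: "count (mset (map snd ?w)) l \<le> count_le l y"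
    unfolding cnt_l by (intro count_le_recording_row)
  \<comment> \<open>The smaller of the two largest admissible positions. It remains to compare it
    with the two smallest admissible positions and with the lengths of the lower rows.\<close>
  define c where "c = min (count_le k r) (count_le l y)"
  have le_len: "count_le k r \<le> length r" "count_le l y \<le> length y"
    by (metis size_filter_mset_lesseq size_mset)+
  have mono: "size {#a \<in># mset z. a < x#} \<le> count_le x z" for x z
    by (rule size_filter_mset_mono) simp
  \<comment> \<open>The labels below \<open>k\<close> number at most the word length minus the count
    of \<open>k\<close>, hence by \<open>d\<close> at most the count of \<open>l\<close>, and so by
    \<open>Q\<close> at most \<open>count_le l y\<close>.\<close>
  have "size {#a \<in># mset r. a < k#} \<le> c"
    using size_filter_less_le[OF w_facts(4), of k] d Q mono[of k r] unfolding c_def by simp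
  then have r1_eq: "r1 = take c r @ k # drop c r"
    by (intro sorted_insert_at w_facts sorted1 r1) (simp_all add: c_def)
  have "size {#a \<in># mset y. a < l#} \<le> c"
    using size_filter_less_le[OF w_facts(5), of l] d w_facts(8) mono[of l y] unfolding c_def by simp
  then have y1_eq: "y1 = take c y @ l # drop c y"
    by (intro sorted_insert_at w_facts sorted1 r1) (simp_all add: c_def)
  \<comment> \<open>The word length is at most \<open>count_le k r + count_le l y\<close>, and each
    summand is at most the common length of the first rows. So the number of boxes below the first
    row is bounded by either summand.\<close>
  have "length ?w - length r \<le> c"
    using d Q w_facts(3,8) le_len unfolding c_def by linarith
  then have "\<forall>x\<in>set rs. length x \<le> c" "\<forall>x\<in>set ys. length x \<le> c"
    using w_facts(3,6,7) member_le_sum_list[of _ "map length rs"] member_le_sum_list[of _ "map length ys"]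
    by fastforce+
  then have "bitableau (r1 # rs) (y1 # ys) = zvar k l * bitableau (r # rs) (y # ys)"
    unfolding r1_eq y1_eq using le_len w_facts(3)
    by (intro bitableau_insert_singleton_column) (auto simp: c_def)
  then show ?thesis by (simp only: word_bitableau_eq w w1 prod.case)
qed

section \<open>Multiplication by a variable\<close>

lemma sorted_map_concat:
  assumes "sorted js" "\<And>j a. j \<in> set js \<Longrightarrow> a \<in> set (c j) \<Longrightarrow> g a = (j :: nat)"
  shows "sorted (map g (concat (map c js)))"
  using assms
proof (induction js)
  case (Cons j js)
  have "map g (c j) = replicate (length (c j)) j"
    using Cons.prems(2) by (intro replicate_eqI) auto
  then have "sorted (map g (c j))" by (simp only: sorted_replicate)
  moreover have "g a \<le> g b" if "a \<in> set (c j)" "x \<in> set js" "b \<in> set (c x)" for a x b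
    using that Cons.prems(1) Cons.prems(2)[of j a] Cons.prems(2)[of x b] by simp
  ultimately show ?case using Cons by (auto simp: sorted_append)
qed simp

lemma count_map_concat:
  "count (mset (map g (concat (map c js)))) x = (\<Sum>j\<leftarrow>js. count (mset (map g (c j))) x)"
  by (induction js) auto

lemma biletters_split:
  assumes "k \<in> {1..m}" "l \<in> {1..n}"
  obtains u v1 v2 t where
    "biletters m n \<alpha> = u @ v1 @ replicate (Poly_Mapping.lookup \<alpha> (k, l)) (k, l) @ v2 @ t"
    "biletters m n (\<alpha> + Poly_Mapping.single (k, l) 1)
      = u @ v1 @ replicate (Suc (Poly_Mapping.lookup \<alpha> (k, l))) (k, l) @ v2 @ t"
    "\<forall>a\<in>set u. snd a < l" "\<forall>a\<in>set (v1 @ v2). snd a = l" "\<forall>a\<in>set t. l < snd a"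
    "\<forall>a\<in>set v1. fst a < k" "\<forall>a\<in>set v2. k < fst a" "sorted (map fst (v1 @ v2))"
proof -
  define c where "c \<alpha> j i = replicate (Poly_Mapping.lookup \<alpha> (i, j)) (i, j)"
    for \<alpha> :: expo and i j
  define C where "C \<alpha> j = concat (map (c \<alpha> j) [1..<Suc m])" for \<alpha> j
  let ?\<alpha>' = "\<alpha> + Poly_Mapping.single (k, l) 1"
  define u where "u = concat (map (C \<alpha>) [1..<l])"
  define t where "t = concat (map (C \<alpha>) [Suc l..<Suc n])"
  define v1 where "v1 = concat (map (c \<alpha> l) [1..<k])"
  define v2 where "v2 = concat (map (c \<alpha> l) [Suc k..<Suc m])"
  have split: "[1..<Suc b] = [1..<a] @ a # [Suc a..<Suc b]" if "a \<in> {1..b}" for a b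
    using that upt_add_eq_append[of 1 a "Suc b - a"] by (simp add: upt_conv_Cons del: upt_Suc)
  have bil: "biletters m n \<beta> = concat (map (C \<beta>) [1..<Suc n])" for \<beta>
    by (simp add: biletters_def C_def[abs_def] c_def[abs_def] del: upt_Suc)
  \<comment> \<open>Stated for every exponent \<open>\<beta>\<close>, so that both words are cut at
    the same places.\<close>
  have bil': "biletters m n \<beta> = concat (map (C \<beta>) [1..<l]) @
      (concat (map (c \<beta> l) [1..<k]) @ c \<beta> l k @ concat (map (c \<beta> l) [Suc k..<Suc m])) @
      concat (map (C \<beta>) [Suc l..<Suc n])" for \<beta>
    unfolding bil split[OF assms(2)] by (simp add: C_def split[OF assms(1)] del: upt_Suc One_nat_def)
  have c': "c ?\<alpha>' j i = c \<alpha> j i" if "(i, j) \<noteq> (k, l)" for i j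
    using that by (auto simp: c_def lookup_add lookup_single when_def)
  have C': "C ?\<alpha>' j = C \<alpha> j" if "j \<noteq> l" for j
    unfolding C_def using that c' by (intro arg_cong[where f = concat] map_cong) auto
  have "concat (map (C ?\<alpha>') [1..<l]) = u" "concat (map (C ?\<alpha>') [Suc l..<Suc n]) = t"
    unfolding u_def t_def by (intro arg_cong[where f = concat] map_cong refl C'; auto)+
  moreover have "concat (map (c ?\<alpha>' l) [1..<k]) = v1" "concat (map (c ?\<alpha>' l) [Suc k..<Suc m]) = v2"
    unfolding v1_def v2_def by (intro arg_cong[where f = concat] map_cong refl c'; auto)+
  moreover have "c ?\<alpha>' l k = replicate (Suc (Poly_Mapping.lookup \<alpha> (k, l))) (k, l)"
    by (simp add: c_def lookup_add)
  ultimately have b: "biletters m n ?\<alpha>'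
      = u @ v1 @ replicate (Suc (Poly_Mapping.lookup \<alpha> (k, l))) (k, l) @ v2 @ t"
    unfolding bil' by simp
  have a: "biletters m n \<alpha> = u @ v1 @ replicate (Poly_Mapping.lookup \<alpha> (k, l)) (k, l) @ v2 @ t"
    unfolding bil' u_def v1_def v2_def t_def by (simp add: c_def del: upt_Suc)
  have v: "v1 @ v2 = concat (map (c \<alpha> l) ([1..<k] @ [Suc k..<Suc m]))"
    by (simp add: v1_def v2_def del: upt_Suc)
  have "sorted (map fst (v1 @ v2))"
    unfolding v by (rule sorted_map_concat) (auto simp: c_def sorted_append)
  then show thesis
    by (rule that[OF a b, rotated 5])
       (auto simp: u_def v1_def v2_def t_def c_def C_def simp del: upt_Suc)
qed

lemma sorted_snd_biletters: "sorted (map snd (biletters m n \<alpha>))"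
  unfolding biletters_def by (rule sorted_map_concat) (auto simp del: upt_Suc)

lemma sum_list_upt_Suc: "(\<Sum>i\<leftarrow>[1..<Suc n]. f i) = (\<Sum>i=1..n. f i :: nat)"
  by (simp add: interv_sum_list_conv_sum_set_nat atLeastLessThanSuc_atLeastAtMost del: upt_Suc)

lemma count_fst_biletters:
  assumes "k \<in> {1..m}"
  shows "count (mset (map fst (biletters m n \<alpha>))) k = (\<Sum>j=1..n. Poly_Mapping.lookup \<alpha> (k, j))"
  using assms unfolding biletters_def count_map_concat sum_list_upt_Suc
  by (simp add: if_distrib cong: if_cong)

lemma count_snd_biletters:
  assumes "l \<in> {1..n}"
  shows "count (mset (map snd (biletters m n \<alpha>))) l = (\<Sum>i=1..m. Poly_Mapping.lookup \<alpha> (i, l))"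
proof -
  have "(\<Sum>i=1..m. count (mset (map snd (replicate (Poly_Mapping.lookup \<alpha> (i, j)) (i, j)))) l)
      = (if j = l then \<Sum>i=1..m. Poly_Mapping.lookup \<alpha> (i, j) else 0)" for j
    by (cases "j = l") simp_all
  then show ?thesis
    using assms unfolding biletters_def count_map_concat sum_list_upt_Suc by simp
qed

lemma length_biletters:
  "length (biletters m n \<alpha>) = (\<Sum>j=1..n. \<Sum>i=1..m. Poly_Mapping.lookup \<alpha> (i, j))"
  unfolding biletters_def length_concat map_map comp_def sum_list_upt_Suc length_replicate ..

lemma RSK_op_zmonom: "RSK_op m n (zmonom \<alpha>) = word_bitableau (biletters m n \<alpha>)"
  by (simp add: RSK_op_def zmonom_def RSK_def word_bitableau_def)

lemma RSK_op_mult_zvar: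
  assumes "(\<sigma>, \<pi>) \<in> weight_pairs m n d" "k \<in> {1..m}" "l \<in> {1..n}"
    and "d \<le> Poly_Mapping.lookup \<sigma> k + Poly_Mapping.lookup \<pi> l" "\<alpha> \<in> Cont m n \<sigma> \<pi>"
  shows "RSK_op m n (zmonom (\<alpha> + Poly_Mapping.single (k, l) 1))
    = zvar k l * RSK_op m n (zmonom \<alpha>)"
proof -
  obtain u v1 v2 t where
    s: "biletters m n \<alpha> = u @ v1 @ replicate (Poly_Mapping.lookup \<alpha> (k, l)) (k, l) @ v2 @ t"
    "biletters m n (\<alpha> + Poly_Mapping.single (k, l) 1)
      = u @ v1 @ replicate (Suc (Poly_Mapping.lookup \<alpha> (k, l))) (k, l) @ v2 @ t"
    "\<forall>a\<in>set u. snd a < l" "\<forall>a\<in>set (v1 @ v2). snd a = l" "\<forall>a\<in>set t. l < snd a"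
    "\<forall>a\<in>set v1. fst a < k" "\<forall>a\<in>set v2. k < fst a" "sorted (map fst (v1 @ v2))"
    using biletters_split[OF assms(2,3)] by metis
  have "(\<Sum>j=1..n. \<Sum>i=1..m. Poly_Mapping.lookup \<alpha> (i, j)) = d"
    using assms(1,5) by (simp add: Cont_def weight_pairs_def)
  \<comment> \<open>The word has length \<open>d\<close>, and its counts of \<open>k\<close> and
    \<open>l\<close> are a row sum and a column sum of \<open>\<alpha>\<close>: the covering
    condition becomes the counting hypothesis on words.\<close>
  then have "length (biletters m n \<alpha>) \<le> count (mset (map fst (biletters m n \<alpha>))) k
      + count (mset (map snd (biletters m n \<alpha>))) l"
    unfolding length_biletters count_fst_biletters[OF assms(2)] count_snd_biletters[OF assms(3)]
    using assms by (simp add: Cont_def)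
  then have d: "length (u @ v1 @ replicate (Poly_Mapping.lookup \<alpha> (k, l)) (k, l) @ v2 @ t) \<le>
      count (mset (map fst (u @ v1 @ replicate (Poly_Mapping.lookup \<alpha> (k, l)) (k, l) @ v2 @ t))) k
      + count (mset (map snd (u @ v1 @ replicate (Poly_Mapping.lookup \<alpha> (k, l)) (k, l) @ v2 @ t))) l"
    unfolding s(1) .
  have "sorted (map snd (u @ v1 @ replicate (Poly_Mapping.lookup \<alpha> (k, l)) (k, l) @ v2 @ t))"
    using sorted_snd_biletters[of m n \<alpha>] unfolding s(1) .
  then show ?thesis
    unfolding RSK_op_zmonom s(1,2) by (rule word_bitableau_replicate_Suc) (fact s d)+
qed

section \<open>Monomial bases of weight spaces related by a cover\<close>

lemma lookup_zvar_mult: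
  "Poly_Mapping.lookup (zvar k l * f) (\<beta> + Poly_Mapping.single (k, l) 1) = Poly_Mapping.lookup f \<beta>"
proof -
  have "(\<beta> + Poly_Mapping.single (k, l) 1 = Poly_Mapping.single (k, l) 1 + q) \<longleftrightarrow> \<beta> = q" for q
    by (metis add.commute add_left_cancel)
  then show ?thesis
    by (simp add: zvar_def zmonom_def lookup_mult lookup_single when_mult)
qed

lemma lex_greater_add: "lex_greater (\<alpha> + \<gamma>) (\<beta> + \<gamma>) \<longleftrightarrow> lex_greater \<alpha> \<beta>"
  by (simp add: lex_greater_def lookup_add)

lemma sum_add_single:
  assumes "finite A" "k \<in> A"
  shows "(\<Sum>i\<in>A. Poly_Mapping.lookup (\<sigma> + Poly_Mapping.single k (1::nat)) i)
    = Suc (\<Sum>i\<in>A. Poly_Mapping.lookup \<sigma> i)"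
  using assms by (simp add: lookup_add lookup_single sum.distrib when_def)

lemma keys_add_single:
  "Poly_Mapping.keys (\<sigma> + Poly_Mapping.single k (1::nat)) = insert k (Poly_Mapping.keys \<sigma>)"
  by (auto simp: in_keys_iff lookup_add lookup_single when_def split: if_splits)

lemma obtain_add_single:
  assumes "1 \<le> Poly_Mapping.lookup \<sigma> k"
  obtains \<tau> where "\<sigma> = \<tau> + Poly_Mapping.single k (1::nat)"
proof
  show "\<sigma> = \<sigma> - Poly_Mapping.single k 1 + Poly_Mapping.single k (1::nat)"
    using assms
    by (intro poly_mapping_eqI) (auto simp: lookup_add lookup_minus lookup_single when_def)
qed

lemma weight_pairs_add_single:
  assumes "k \<in> {1..m}" "l \<in> {1..n}"
  shows "(\<sigma> + Poly_Mapping.single k 1, \<pi> + Poly_Mapping.single l 1) \<in> weight_pairs m n (Suc d)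
    \<longleftrightarrow> (\<sigma>, \<pi>) \<in> weight_pairs m n d"
  using assms by (simp add: weight_pairs_def sum_add_single keys_add_single del: One_nat_def)

lemma Cont_add_single_iff:
  assumes "k \<in> {1..m}" "l \<in> {1..n}"
  shows "\<alpha> + Poly_Mapping.single (k, l) 1
      \<in> Cont m n (\<sigma> + Poly_Mapping.single k 1) (\<pi> + Poly_Mapping.single l 1)
    \<longleftrightarrow> \<alpha> \<in> Cont m n \<sigma> \<pi>"
proof -
  have rows: "(\<Sum>j=1..n. Poly_Mapping.lookup (\<alpha> + Poly_Mapping.single (k, l) 1) (i, j))
      = (\<Sum>j=1..n. Poly_Mapping.lookup \<alpha> (i, j)) + (if i = k then 1 else 0)" for i
    using assms by (auto simp: lookup_add lookup_single sum.distrib when_def)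
  have columns: "(\<Sum>i=1..m. Poly_Mapping.lookup (\<alpha> + Poly_Mapping.single (k, l) 1) (i, j))
      = (\<Sum>i=1..m. Poly_Mapping.lookup \<alpha> (i, j)) + (if j = l then 1 else 0)" for j
    using assms by (auto simp: lookup_add lookup_single sum.distrib when_def)
  have weight: "Poly_Mapping.lookup (\<tau> + Poly_Mapping.single k 1) i
      = Poly_Mapping.lookup \<tau> i + (if i = k then 1 else 0)" for \<tau> :: weight and k i
    by (simp add: lookup_add lookup_single when_def)
  show ?thesis
    unfolding Cont_def mem_Collect_eq keys_add_single rows columns weight add_right_cancel
    using assms by simp
qed

text \<open>The point is surjectivity. In a matrix of the larger set, row \<open>k\<close> and
  column \<open>l\<close> meet only at \<open>(k, l)\<close> and their sums add up to at least
  \<open>d + 2\<close>, while all entries add up to \<open>d + 1\<close>; so the common entry is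
  positive.\<close>

lemma Cont_add_single:
  assumes wp: "(\<sigma>, \<pi>) \<in> weight_pairs m n d" and kl: "k \<in> {1..m}" "l \<in> {1..n}"
    and d: "d \<le> Poly_Mapping.lookup \<sigma> k + Poly_Mapping.lookup \<pi> l"
  shows "Cont m n (\<sigma> + Poly_Mapping.single k 1) (\<pi> + Poly_Mapping.single l 1)
    = (\<lambda>\<alpha>. \<alpha> + Poly_Mapping.single (k, l) 1) ` Cont m n \<sigma> \<pi>" (is "?C' = _ ` ?C")
proof (intro equalityI subsetI)
  fix \<beta> assume \<beta>: "\<beta> \<in> ?C'"
  let ?b = "Poly_Mapping.lookup \<beta>"
  have "Suc d = (\<Sum>i=1..m. \<Sum>j=1..n. ?b (i, j))"
    using \<beta> wp sum_add_single[of "{1..m}" k \<sigma>] kl by (simp add: Cont_def weight_pairs_def)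
  also have "\<dots> = (\<Sum>j=1..n. ?b (k, j)) + (\<Sum>i\<in>{1..m} - {k}. \<Sum>j=1..n. ?b (i, j))"
    using kl by (simp add: sum.remove)
  also have "\<dots> \<ge> (\<Sum>j=1..n. ?b (k, j)) + (\<Sum>i\<in>{1..m} - {k}. ?b (i, l))"
    using kl by (intro add_left_mono sum_mono member_le_sum) auto
  finally have "(\<Sum>j=1..n. ?b (k, j)) + (\<Sum>i\<in>{1..m} - {k}. ?b (i, l)) \<le> Suc d" .
  moreover have "(\<Sum>j=1..n. ?b (k, j)) = Suc (Poly_Mapping.lookup \<sigma> k)"
    using \<beta> kl by (simp add: Cont_def lookup_add)
  moreover have "(\<Sum>i=1..m. ?b (i, l)) = ?b (k, l) + (\<Sum>i\<in>{1..m} - {k}. ?b (i, l))"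
    using kl by (simp add: sum.remove)
  moreover have "(\<Sum>i=1..m. ?b (i, l)) = Suc (Poly_Mapping.lookup \<pi> l)"
    using \<beta> kl by (simp add: Cont_def lookup_add)
  ultimately have "1 \<le> ?b (k, l)" using d by simp
  then obtain \<alpha> where "\<beta> = \<alpha> + Poly_Mapping.single (k, l) 1" by (rule obtain_add_single)
  then show "\<beta> \<in> (\<lambda>\<alpha>. \<alpha> + Poly_Mapping.single (k, l) 1) ` ?C"
    using \<beta> Cont_add_single_iff[OF kl] by blast
qed (use Cont_add_single_iff[OF kl] in blast)

text \<open>Multiplication by the variable preserves the monomial order, so the two index lists
  correspond position by position. \<open>RSK_op_mult_zvar\<close> and
  \<open>lookup_zvar_mult\<close> then equate the entries.\<close>

lemma RSK_matrix_add_single: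
  assumes wp: "(\<sigma>, \<pi>) \<in> weight_pairs m n d" and kl: "k \<in> {1..m}" "l \<in> {1..n}"
    and d: "d \<le> Poly_Mapping.lookup \<sigma> k + Poly_Mapping.lookup \<pi> l"
  shows "RSK_matrix m n (\<sigma> + Poly_Mapping.single k 1) (\<pi> + Poly_Mapping.single l 1)
    = RSK_matrix m n \<sigma> \<pi>"
proof -
  let ?as = "Cont_list m n \<sigma> \<pi>" and ?f = "\<lambda>\<alpha>. \<alpha> + Poly_Mapping.single (k, l) 1"
  have "set (map ?f ?as) = Cont m n (\<sigma> + Poly_Mapping.single k 1) (\<pi> + Poly_Mapping.single l 1) \<and>
      sorted_wrt lex_greater (map ?f ?as)"
    using Cont_list by (simp add: Cont_add_single[OF assms] sorted_wrt_map lex_greater_add del: One_nat_def)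
  then have list: "Cont_list m n (\<sigma> + Poly_Mapping.single k 1) (\<pi> + Poly_Mapping.single l 1)
      = map ?f ?as"
    unfolding Cont_list_def by (rule the1_equality[OF Cont_list_unique])
  have "?as ! a \<in> Cont m n \<sigma> \<pi>" if "a < length ?as" for a
    using nth_mem[OF that] by (simp add: Cont_list)
  then show ?thesis
    unfolding RSK_matrix_def Let_def list
    by (intro cong_mat) (auto simp: RSK_op_mult_zvar[OF assms, simplified] lookup_zvar_mult[simplified])
qed

section \<open>The poset of weight pairs\<close>

lemma wp_cover_weight_pairs:
  assumes "wp_cover m n x y"
  shows "\<exists>d. x \<in> weight_pairs m n d \<and> y \<in> weight_pairs m n (Suc d)"
  using assms weight_pairs_add_single unfolding wp_cover_def by blast

lemma RSK_matrix_wp_cover: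
  assumes "wp_cover m n x y"
  shows "(case x of (\<sigma>, \<pi>) \<Rightarrow> RSK_matrix m n \<sigma> \<pi>) = (case y of (\<sigma>, \<pi>) \<Rightarrow> RSK_matrix m n \<sigma> \<pi>)"
  using assms RSK_matrix_add_single unfolding wp_cover_def by fastforce

lemma weight_pairs_lookup_le:
  assumes "(\<sigma>, \<pi>) \<in> weight_pairs m n d" "k \<in> {1..m}" "l \<in> {1..n}"
  shows "Poly_Mapping.lookup \<sigma> k \<le> d" "Poly_Mapping.lookup \<pi> l \<le> d"
  using assms member_le_sum[of k "{1..m}" "Poly_Mapping.lookup \<sigma>"]
    member_le_sum[of l "{1..n}" "Poly_Mapping.lookup \<pi>"] by (auto simp: weight_pairs_def)

lemma sum_two_le:
  fixes f :: "nat \<Rightarrow> nat"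
  assumes "finite A" "k \<in> A" "k' \<in> A" "k \<noteq> k'"
  shows "f k + f k' \<le> sum f A"
  using sum_mono2[of A "{k, k'}" f] assms by simp

text \<open>\<open>\<rho>\<close> is the common sum with both units removed; it supplies one
  component of the bottom of a diamond.\<close>

lemma add_single_swap:
  assumes "\<pi> + Poly_Mapping.single l (1::nat) = \<pi>' + Poly_Mapping.single l' 1" "l \<noteq> l'"
  obtains \<rho> where "\<pi> = \<rho> + Poly_Mapping.single l' 1" "\<pi>' = \<rho> + Poly_Mapping.single l 1"
proof -
  have "Poly_Mapping.lookup \<pi> l' = Suc (Poly_Mapping.lookup \<pi>' l')"
    using assms(2) arg_cong[OF assms(1), of "\<lambda>f. Poly_Mapping.lookup f l'"]
    by (simp add: lookup_add lookup_single)
  then obtain \<rho> where \<rho>: "\<pi> = \<rho> + Poly_Mapping.single l' 1"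
    by (metis obtain_add_single One_nat_def Suc_le_mono zero_le)
  then have "\<pi>' + Poly_Mapping.single l' 1 = (\<rho> + Poly_Mapping.single l 1) + Poly_Mapping.single l' 1"
    using assms(1) by (simp add: ac_simps)
  then have "\<pi>' = \<rho> + Poly_Mapping.single l 1" by (rule add_right_imp_eq)
  with \<rho> show thesis by (rule that)
qed

text \<open>Here \<open>d\<close> is the degree of the upper pair, unlike in
  \<open>wp_cover\<close>. The strict bound with 2 states the covering condition for
  \<open>d - 1\<close> without subtraction.\<close>

lemma wp_coverI:
  assumes "(\<sigma> + Poly_Mapping.single k 1, \<pi> + Poly_Mapping.single l 1) \<in> weight_pairs m n d"
    and "k \<in> {1..m}" "l \<in> {1..n}" "d < 2 + Poly_Mapping.lookup \<sigma> k + Poly_Mapping.lookup \<pi> l"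
  shows "wp_cover m n (\<sigma>, \<pi>) (\<sigma> + Poly_Mapping.single k 1, \<pi> + Poly_Mapping.single l 1)"
proof -
  obtain d' where "d = Suc d'"
    using weight_pairs_lookup_le(1)[OF assms(1-3)] by (cases d) (auto simp: lookup_add)
  then have "(\<sigma>, \<pi>) \<in> weight_pairs m n d'" "d' \<le> Poly_Mapping.lookup \<sigma> k + Poly_Mapping.lookup \<pi> l"
    using assms(1,4) weight_pairs_add_single[OF assms(2,3)] by auto
  then show ?thesis using assms(2,3) unfolding wp_cover_def by blast
qed

lemma wp_cover_diamond:
  assumes "wp_cover m n y x" "wp_cover m n y' x"
  shows "y = y' \<or> (\<exists>z. wp_cover m n z y \<and> wp_cover m n z y')"
proof -
  obtain \<sigma> \<pi> d k l where 1: "y = (\<sigma>, \<pi>)" "(\<sigma>, \<pi>) \<in> weight_pairs m n d" "k \<in> {1..m}" "l \<in> {1..n}"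
    "d \<le> Poly_Mapping.lookup \<sigma> k + Poly_Mapping.lookup \<pi> l"
    "x = (\<sigma> + Poly_Mapping.single k 1, \<pi> + Poly_Mapping.single l 1)"
    using assms(1) unfolding wp_cover_def by blast
  obtain \<sigma>' \<pi>' d' k' l' where 2: "y' = (\<sigma>', \<pi>')" "(\<sigma>', \<pi>') \<in> weight_pairs m n d'" "k' \<in> {1..m}"
    "l' \<in> {1..n}" "d' \<le> Poly_Mapping.lookup \<sigma>' k' + Poly_Mapping.lookup \<pi>' l'"
    "x = (\<sigma>' + Poly_Mapping.single k' 1, \<pi>' + Poly_Mapping.single l' 1)"
    using assms(2) unfolding wp_cover_def by blast
  have eq: "\<sigma> + Poly_Mapping.single k 1 = \<sigma>' + Poly_Mapping.single k' 1"
    "\<pi> + Poly_Mapping.single l 1 = \<pi>' + Poly_Mapping.single l' 1"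
    using 1(6) 2(6) by auto
  have "x \<in> weight_pairs m n (Suc d')"
    unfolding 2(6) weight_pairs_add_single[OF 2(3,4)] by (rule 2(2))
  moreover have x: "x \<in> weight_pairs m n (Suc d)"
    unfolding 1(6) weight_pairs_add_single[OF 1(3,4)] by (rule 1(2))
  ultimately have d': "d' = d" by (auto simp: weight_pairs_def)
  consider "k = k'" "l = l'" | "k = k'" "l \<noteq> l'" | "k \<noteq> k'" "l = l'" | "k \<noteq> k'" "l \<noteq> l'"
    by blast
  then show ?thesis
  proof cases
    case 1
    then show ?thesis using eq \<open>y = _\<close> \<open>y' = _\<close> by simp
  next
    case 2
    obtain \<rho> where \<rho>: "\<pi> = \<rho> + Poly_Mapping.single l' 1" "\<pi>' = \<rho> + Poly_Mapping.single l 1"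
      using add_single_swap[OF eq(2) 2(2)] .
    have \<sigma>': "\<sigma>' = \<sigma>" using eq(1) 2(1) by simp
    have le: "d \<le> Poly_Mapping.lookup \<sigma> k + Poly_Mapping.lookup \<rho> l"
      "d \<le> Poly_Mapping.lookup \<sigma> k + Poly_Mapping.lookup \<rho> l'"
      using 1(5) \<open>d' \<le> _\<close> 2 \<rho> \<sigma>' d' by (simp_all add: lookup_add lookup_single)
    \<comment> \<open>The bottom of the diamond also lacks one unit of \<open>\<sigma>\<close> at
      \<open>k\<close>, so this entry must be shown positive.\<close>
    have "Poly_Mapping.lookup \<rho> l' < d"
      using weight_pairs_lookup_le(2)[OF 1(2,3) \<open>l' \<in> _\<close>] \<rho> by (simp add: lookup_add)
    then have "1 \<le> Poly_Mapping.lookup \<sigma> k" using le by simp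
    then obtain \<tau> where \<tau>: "\<sigma> = \<tau> + Poly_Mapping.single k 1" by (rule obtain_add_single)
    have "wp_cover m n (\<tau>, \<rho>) (\<tau> + Poly_Mapping.single k 1, \<rho> + Poly_Mapping.single l' 1)"
      using 1(2,3) \<open>l' \<in> _\<close> le by (intro wp_coverI[of _ _ _ _ _ _ d]) (simp_all add: \<tau> \<rho> lookup_add)
    moreover have "wp_cover m n (\<tau>, \<rho>) (\<tau> + Poly_Mapping.single k 1, \<rho> + Poly_Mapping.single l 1)"
      using \<open>(\<sigma>', \<pi>') \<in> _\<close> 1(3,4) le \<sigma>' d'
      by (intro wp_coverI[of _ _ _ _ _ _ d]) (simp_all add: \<tau> \<rho> lookup_add)
    ultimately show ?thesis using \<open>y = _\<close> \<open>y' = _\<close> \<sigma>' \<tau> \<rho> by auto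
  next
    case 3
    obtain \<rho> where \<rho>: "\<sigma> = \<rho> + Poly_Mapping.single k' 1" "\<sigma>' = \<rho> + Poly_Mapping.single k 1"
      using add_single_swap[OF eq(1) 3(1)] .
    have \<pi>': "\<pi>' = \<pi>" using eq(2) 3(2) by simp
    have le: "d \<le> Poly_Mapping.lookup \<rho> k + Poly_Mapping.lookup \<pi> l"
      "d \<le> Poly_Mapping.lookup \<rho> k' + Poly_Mapping.lookup \<pi> l"
      using 1(5) \<open>d' \<le> _\<close> 3 \<rho> \<pi>' d' by (simp_all add: lookup_add lookup_single)
    have "Poly_Mapping.lookup \<rho> k' < d"
      using weight_pairs_lookup_le(1)[OF 1(2) \<open>k' \<in> _\<close> 1(4)] \<rho> by (simp add: lookup_add)
    then have "1 \<le> Poly_Mapping.lookup \<pi> l" using le by simp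
    then obtain \<tau> where \<tau>: "\<pi> = \<tau> + Poly_Mapping.single l 1" by (rule obtain_add_single)
    have "wp_cover m n (\<rho>, \<tau>) (\<rho> + Poly_Mapping.single k' 1, \<tau> + Poly_Mapping.single l 1)"
      using 1(2,4) \<open>k' \<in> _\<close> le by (intro wp_coverI[of _ _ _ _ _ _ d]) (simp_all add: \<tau> \<rho> lookup_add)
    moreover have "wp_cover m n (\<rho>, \<tau>) (\<rho> + Poly_Mapping.single k 1, \<tau> + Poly_Mapping.single l 1)"
      using \<open>(\<sigma>', \<pi>') \<in> _\<close> 1(3,4) le \<pi>' d'
      by (intro wp_coverI[of _ _ _ _ _ _ d]) (simp_all add: \<tau> \<rho> lookup_add)
    ultimately show ?thesis using \<open>y = _\<close> \<open>y' = _\<close> \<pi>' \<tau> \<rho> by auto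
  next
    case 4
    let ?s = "Poly_Mapping.lookup (\<sigma> + Poly_Mapping.single k 1)"
      and ?p = "Poly_Mapping.lookup (\<pi> + Poly_Mapping.single l 1)"
    \<comment> \<open>This case is contradictory: the four entries of \<open>x\<close> sum to at
      most \<open>2 * (d + 1)\<close>, but the two covering conditions demand
      \<open>2 * (d + 2)\<close>.\<close>
    have "?s k + ?s k' \<le> Suc d"
      using sum_two_le[of "{1..m}" k k' ?s] 4 1(3,6) 2(3) x by (simp add: weight_pairs_def)
    moreover have "?p l + ?p l' \<le> Suc d"
      using sum_two_le[of "{1..n}" l l' ?p] 4 1(4,6) 2(4) x by (simp add: weight_pairs_def)
    moreover have "Suc (Suc d) \<le> ?s k + ?p l" using 1(5) by (simp add: lookup_add)
    moreover have "Suc (Suc d) \<le> ?s k' + ?p l'"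
      using 2(5) d' unfolding eq by (simp add: lookup_add)
    ultimately show ?thesis by linarith
  qed
qed

section \<open>Existence and uniqueness of the reduction\<close>

lemma confluentp_wp_cover_converse: "confluentp (wp_cover m n)\<inverse>\<inverse>"
proof (intro strong_confluentp_imp_confluentp strong_confluentpI)
  fix x y z
  assume "(wp_cover m n)\<inverse>\<inverse> x y" "(wp_cover m n)\<inverse>\<inverse> x z"
  then have "y = z \<or> (\<exists>u. wp_cover m n u y \<and> wp_cover m n u z)"
    using wp_cover_diamond unfolding conversep_iff by blast
  then show "\<exists>u. (wp_cover m n)\<inverse>\<inverse>\<^sup>*\<^sup>* y u \<and> ((wp_cover m n)\<inverse>\<inverse>)\<^sup>=\<^sup>= z u"
  proof (elim disjE exE conjE)
    assume "y = z"
    then show ?thesis by (intro exI[of _ z]) simp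
  next
    fix u
    assume "wp_cover m n u y" "wp_cover m n u z"
    then show ?thesis by (intro exI[of _ u]) auto
  qed
qed

text \<open>Each downward cover lowers the degree by one, so descent terminates.\<close>

lemma ex_wp_reduced_below:
  "x \<in> weight_pairs m n d \<Longrightarrow> \<exists>y. wp_le m n y x \<and> wp_reduced m n y"
proof (induction d arbitrary: x rule: less_induct)
  case (less d)
  show ?case
  proof (cases "wp_reduced m n x")
    case True
    then show ?thesis unfolding wp_le_def by blast
  next
    case False
    then obtain y where "wp_le m n y x" "y \<noteq> x" using less.prems unfolding wp_reduced_def by blast
    \<comment> \<open>A chain from some \<open>y \<noteq> x\<close> up to \<open>x\<close> is
      nontrivial, and its last link is a cover.\<close>
    then obtain z where z: "wp_cover m n z x" unfolding wp_le_def by (metis rtranclp.cases)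
    then obtain d' where "z \<in> weight_pairs m n d'" "x \<in> weight_pairs m n (Suc d')"
      using wp_cover_weight_pairs by blast
    moreover from this have "d' < d" using less.prems by (auto simp: weight_pairs_def)
    ultimately obtain y where "wp_le m n y z" "wp_reduced m n y" using less.IH by blast
    then show ?thesis using z unfolding wp_le_def by (meson rtranclp.rtrancl_into_rtrancl)
  qed
qed

text \<open>Components are generated by \<open>wp_le\<close>, whereas confluence and equality of
  matrices are established for covers; this bridges the two.\<close>

lemma equivclp_rtranclp: "equivclp r\<^sup>*\<^sup>* = equivclp r"
proof (intro ext iffI)
  show "equivclp r x y" if "equivclp r\<^sup>*\<^sup>* x y" for x y
    using that
  proof (induction rule: equivclp_induct)
    case (step y z)
    then have "equivclp r y z"
      by (meson rtranclp_into_equivclp converse_rtranclp_into_equivclp)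
    with step.IH show ?case by (rule equivclp_trans)
  qed simp
  show "equivclp r\<^sup>*\<^sup>* x y" if "equivclp r x y" for x y
    using that
  proof (induction rule: equivclp_induct)
    case (step y z)
    then show ?case by (meson equivclp_into_equivclp r_into_rtranclp)
  qed simp
qed

lemma wp_reduced_unique:
  assumes "y \<in> wp_component m n x" "wp_reduced m n y" "y' \<in> wp_component m n x" "wp_reduced m n y'"
  shows "y = y'"
proof -
  have "equivclp (wp_cover m n) y y'"
    using assms(1,3) unfolding wp_component_def wp_le_def equivclp_rtranclp
    by (auto intro: equivclp_trans equivclp_sym)
  then have "equivclp (wp_cover m n)\<inverse>\<inverse> y y'" by simp
  \<comment> \<open>By confluence, equivalent pairs have a common lower bound, and minimality
    identifies it with both.\<close>
  then obtain z where "(wp_cover m n)\<^sup>*\<^sup>* z y" "(wp_cover m n)\<^sup>*\<^sup>* z y'"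
    unfolding semiconfluentp_equivclp[OF confluentp_imp_semiconfluentp[OF confluentp_wp_cover_converse]]
    by (auto simp: rtranclp_conversep)
  then show ?thesis using assms(2,4) unfolding wp_reduced_def wp_le_def by metis
qed

lemma RSK_matrix_wp_component:
  assumes "y \<in> wp_component m n x"
  shows "(case y of (\<sigma>, \<pi>) \<Rightarrow> RSK_matrix m n \<sigma> \<pi>) = (case x of (\<sigma>, \<pi>) \<Rightarrow> RSK_matrix m n \<sigma> \<pi>)"
proof -
  have "equivclp (wp_cover m n) x y"
    using assms by (simp add: wp_component_def wp_le_def equivclp_rtranclp)
  then show ?thesis
  proof (induction rule: equivclp_induct)
    case (step y z)
    then show ?case using RSK_matrix_wp_cover by metis
  qed simp
qed

theorem corollary1p8:
  fixes m n d :: nat and \<sigma> \<pi> :: weight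
  assumes "(\<sigma>, \<pi>) \<in> weight_pairs m n d"
  shows "(\<exists>!y. y \<in> wp_component m n (\<sigma>, \<pi>) \<and> wp_reduced m n y) \<and>
    (case wp_reduction m n (\<sigma>, \<pi>) of (\<sigma>red, \<pi>red) \<Rightarrow>
       RSK_matrix m n \<sigma>red \<pi>red = RSK_matrix m n \<sigma> \<pi>)"
proof -
  obtain y where "wp_le m n y (\<sigma>, \<pi>)" "wp_reduced m n y"
    using ex_wp_reduced_below[OF assms] by blast
  moreover from this(1) have "y \<in> wp_component m n (\<sigma>, \<pi>)"
    unfolding wp_component_def by (simp add: equivclp_sym r_into_equivclp)
  ultimately have ex1: "\<exists>!y. y \<in> wp_component m n (\<sigma>, \<pi>) \<and> wp_reduced m n y"
    using wp_reduced_unique by blast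
  then have "wp_reduction m n (\<sigma>, \<pi>) \<in> wp_component m n (\<sigma>, \<pi>)"
    unfolding wp_reduction_def using theI'[OF ex1] by blast
  from RSK_matrix_wp_component[OF this] ex1 show ?thesis by (simp add: case_prod_beta)
qed

end
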